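(* Let $K$ be a field of characteristic $0$, let $n\ge 2$, and let $P\in K[t_1,\ldots,t_n]$ be a homogeneous polynomial of degree $n-1$. Then $P$ is the symbol of a multilinear Lie element of $\mathrm{Nov}\langle X\rangle$, $X=\{x_1,\ldots,x_n\}$ (i.e. $P=P_f$ for some Lie element $f\in\mathrm{Nov}(n)$), if and only if $$\sum_{i=1}^{n}\Bigl(t_i\frac{\partial^2P}{\partial t_i^2}-2\frac{\partial P}{\partial t_i}\Bigr)=0 \qquad\text{and}\qquad \sum_{i=1}^{n}\Bigl(t_i\frac{\partial^3P}{\partial t_i^3}-3\frac{\partial^2P}{\partial t_i^2}\Bigr)=0.$$
   Context: A Novikov algebra over $K$ is a (nonassociative) algebra $(N,\circ)$ satisfying $(a\circ b)\circ c-a\circ(b\circ c)=(b\circ a)\circ c-b\circ(a\circ c)$ and $(a\circ b)\circ c=(a\circ c)\circ b$. Its commutator $[a,b]=a\circ b-b\circ a$ satisfies the Jacobi identity; the resulting Lie algebra is denoted $N^{(-)}$. Let $X=\{x_1,\ldots,x_n\}$ and let $K\{X\}=K[x_i^{(r)}\mid 1\le i\le n,\ r\ge 0]$ be the free commutative differential algebra, with $x_i=x_i^{(0)}$ and derivation $D$ given by $D(x_i^{(r)})=x_i^{(r+1)}$. With the product $f\circ g=f\,D(g)$ it is a Novikov algebra, and (Dzhumadil'daev–Löfwall) the subalgebra of $(K\{X\},\circ)$ generated by $X$ is the free Novikov algebra $\mathrm{Nov}\langle X\rangle$ on $X$; we identify the two. $\mathrm{Nov}(n)$ denotes the multilinear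 component of $\mathrm{Nov}\langle X\rangle$ in $x_1,\ldots,x_n$; it has as basis the differential monomials $x_1^{(\alpha_1)}\cdots x_n^{(\alpha_n)}$ with $\alpha\in\mathbb Z_{\ge0}^n$, $\alpha_1+\cdots+\alpha_n=n-1$. The symbol $P_f$ of $f\in\mathrm{Nov}(n)$ is its image under the linear isomorphism $x_1^{(\alpha_1)}\cdots x_n^{(\alpha_n)}\mapsto t_1^{\alpha_1}\cdots t_n^{\alpha_n}$ from $\mathrm{Nov}(n)$ onto the space of homogeneous polynomials of degree $n-1$ in $K[t_1,\ldots,t_n]$. An element of $\mathrm{Nov}\langle X\rangle$ is a Lie element if it belongs to the Lie subalgebra of $\mathrm{Nov}\langle X\rangle^{(-)}$ generated by $X$. *)

theory Defs
  imports Main "HOL-Library.Poly_Mapping"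
begin

section \<open>Polynomials\<close>

type_synonym 'v monomial = "'v \<Rightarrow>\<^sub>0 nat"
type_synonym ('v, 'k) mpoly = "('v \<Rightarrow>\<^sub>0 nat) \<Rightarrow>\<^sub>0 'k"

abbreviation coeff :: "('v, 'k::zero) mpoly \<Rightarrow> 'v monomial \<Rightarrow> 'k" where
  "coeff \<equiv> Poly_Mapping.lookup"

abbreviation monoms :: "('v, 'k::zero) mpoly \<Rightarrow> 'v monomial set" where
  "monoms \<equiv> Poly_Mapping.keys"

abbreviation expo :: "'v monomial \<Rightarrow> 'v \<Rightarrow> nat" where
  "expo \<equiv> Poly_Mapping.lookup"

abbreviation vars :: "'v monomial \<Rightarrow> 'v set" where
  "vars \<equiv> Poly_Mapping.keys"

definition mdegree :: "'v monomial \<Rightarrow> nat" where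
  "mdegree m = (\<Sum>v\<in>vars m. expo m v)"

definition scale :: "'k \<Rightarrow> ('v, 'k::field) mpoly \<Rightarrow> ('v, 'k) mpoly" where
  "scale c f = Poly_Mapping.single 0 c * f"

definition var :: "'v \<Rightarrow> ('v, 'k::field) mpoly" where
  "var v = Poly_Mapping.single (Poly_Mapping.single v 1) 1"

definition lin_ext :: "('v monomial \<Rightarrow> ('w, 'k::field) mpoly) \<Rightarrow> ('v, 'k) mpoly \<Rightarrow> ('w, 'k) mpoly"
  where "lin_ext \<phi> f = (\<Sum>m\<in>monoms f. scale (coeff f m) (\<phi> m))"

text \<open>Truncated subtraction in the exponent is harmless: the coefficient is \<open>0\<close> when \<open>v\<close> does not
  occur in \<open>m\<close>.\<close>

definition pderiv_monom :: "'v \<Rightarrow> 'v monomial \<Rightarrow> ('v, 'k::field) mpoly" where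
  "pderiv_monom v m = Poly_Mapping.single (m - Poly_Mapping.single v 1) (of_nat (expo m v))"

definition pd :: "'v \<Rightarrow> ('v, 'k::field) mpoly \<Rightarrow> ('v, 'k) mpoly" where
  "pd v = lin_ext (pderiv_monom v)"

definition homogeneous_polys :: "nat \<Rightarrow> nat \<Rightarrow> (nat, 'k::field) mpoly set" where
  "homogeneous_polys n d = {P. \<forall>m\<in>monoms P. vars m \<subseteq> {1..n} \<and> mdegree m = d}"


section \<open>The differential polynomial algebra\<close>

text \<open>The variable \<open>(i, r)\<close> is \<open>x\<^sub>i\<^sup>(\<^sup>r\<^sup>)\<close>. The type allows every \<open>i :: nat\<close>; the
  restriction to \<open>1 \<le> i \<le> n\<close> comes in through the generating set below.\<close>

type_synonym dvar = "nat \<times> nat"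

definition D_monom :: "dvar monomial \<Rightarrow> (dvar, 'k::field) mpoly" where
  "D_monom m = (\<Sum>v\<in>vars m. pderiv_monom v m * var (fst v, Suc (snd v)))"

definition D :: "(dvar, 'k::field) mpoly \<Rightarrow> (dvar, 'k) mpoly" where
  "D = lin_ext D_monom"

definition nov_prod :: "(dvar, 'k::field) mpoly \<Rightarrow> (dvar, 'k) mpoly \<Rightarrow> (dvar, 'k) mpoly"
  (infixl \<open>\<circ>\<^sub>N\<close> 70) where
  "f \<circ>\<^sub>N g = f * D g"

definition nov_bracket :: "(dvar, 'k::field) mpoly \<Rightarrow> (dvar, 'k) mpoly \<Rightarrow> (dvar, 'k) mpoly" where
  "nov_bracket f g = f \<circ>\<^sub>N g - g \<circ>\<^sub>N f"

definition gens :: "nat \<Rightarrow> (dvar, 'k::field) mpoly set" where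
  "gens n = {var (i, 0) | i. i \<in> {1..n}}"

inductive_set subalgebra_gen ::
    "(('v, 'k::field) mpoly \<Rightarrow> ('v, 'k) mpoly \<Rightarrow> ('v, 'k) mpoly) \<Rightarrow> ('v, 'k) mpoly set
      \<Rightarrow> ('v, 'k) mpoly set"
  for mult :: "('v, 'k::field) mpoly \<Rightarrow> ('v, 'k) mpoly \<Rightarrow> ('v, 'k) mpoly"
  and S :: "('v, 'k) mpoly set"
where
  gen: "f \<in> S \<Longrightarrow> f \<in> subalgebra_gen mult S"
| zero: "0 \<in> subalgebra_gen mult S"
| add: "\<lbrakk>f \<in> subalgebra_gen mult S; g \<in> subalgebra_gen mult S\<rbrakk> \<Longrightarrow> f + g \<in> subalgebra_gen mult S"
| scale: "f \<in> subalgebra_gen mult S \<Longrightarrow> scale c f \<in> subalgebra_gen mult S"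
| mult: "\<lbrakk>f \<in> subalgebra_gen mult S; g \<in> subalgebra_gen mult S\<rbrakk> \<Longrightarrow> mult f g \<in> subalgebra_gen mult S"

definition Nov :: "nat \<Rightarrow> (dvar, 'k::field) mpoly set" where
  "Nov n = subalgebra_gen (\<circ>\<^sub>N) (gens n)"

definition lie_elements :: "nat \<Rightarrow> (dvar, 'k::field) mpoly set" where
  "lie_elements n = subalgebra_gen nov_bracket (gens n)"

definition x_degree :: "nat \<Rightarrow> dvar monomial \<Rightarrow> nat" where
  "x_degree i m = (\<Sum>v | v \<in> vars m \<and> fst v = i. expo m v)"

definition Nov_multilinear :: "nat \<Rightarrow> (dvar, 'k::field) mpoly set" where
  "Nov_multilinear n = {f \<in> Nov n. \<forall>m\<in>monoms f. \<forall>i\<in>{1..n}. x_degree i m = 1}"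

text \<open>A factor \<open>x\<^sub>i\<^sup>(\<^sup>r\<^sup>)\<close> is sent to \<open>t\<^sub>i\<^sup>r\<close>, so that
  \<open>x\<^sub>1\<^sup>(\<^sup>a\<^sup>) \<cdots> x\<^sub>n\<^sup>(\<^sup>z\<^sup>)\<close> becomes \<open>t\<^sub>1\<^sup>a \<cdots> t\<^sub>n\<^sup>z\<close> (lemma
  \<open>symbol_multilinear_monom\<close>). Only the values on \<open>Nov_multilinear n\<close> are meaningful.\<close>

definition symbol_monom :: "dvar monomial \<Rightarrow> nat monomial" where
  "symbol_monom m = (\<Sum>v\<in>vars m. Poly_Mapping.single (fst v) (expo m v * snd v))"

definition symbol :: "(dvar, 'k::field) mpoly \<Rightarrow> (nat, 'k) mpoly" where
  "symbol = lin_ext (\<lambda>m. Poly_Mapping.single (symbol_monom m) 1)"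


section \<open>Basic properties of these notions\<close>

lemma coeff_scale: "coeff (scale c f) m = c * coeff f m"
  unfolding scale_def mult_map_scale_conv_mult[symmetric]
  by (simp add: Poly_Mapping.map.rep_eq when_def)

lemma scale_add_left: "scale (c + d) f = scale c f + scale d f"
  by (simp add: scale_def single_add distrib_right)

lemma scale_add_right: "scale c (f + g) = scale c f + scale c g"
  by (simp add: scale_def distrib_left)

lemma scale_zero [simp]: "scale 0 f = 0" "scale c 0 = 0"
  by (simp_all add: scale_def)

lemma scale_one [simp]: "scale 1 f = f"
  by (simp add: scale_def)

lemma scale_scale: "scale c (scale d f) = scale (c * d) f"
  by (simp add: scale_def mult_single mult.assoc[symmetric])

lemma scale_sum: "scale c (sum g A) = (\<Sum>a\<in>A. scale c (g a))"
  by (simp add: scale_def sum_distrib_left)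

lemma lin_ext_superset:
  assumes "finite A" "monoms f \<subseteq> A"
  shows "lin_ext \<phi> f = (\<Sum>m\<in>A. scale (coeff f m) (\<phi> m))"
  unfolding lin_ext_def by (rule sum.mono_neutral_left) (use assms in \<open>auto simp: in_keys_iff\<close>)

lemma lin_ext_add: "lin_ext \<phi> (f + g) = lin_ext \<phi> f + lin_ext \<phi> g"
proof -
  let ?A = "monoms f \<union> monoms g"
  have "lin_ext \<phi> h = (\<Sum>m\<in>?A. scale (coeff h m) (\<phi> m))" if "h \<in> {f, g, f + g}" for h
    by (rule lin_ext_superset) (use that Poly_Mapping.keys_add[of f g] in auto)
  then show ?thesis
    by (simp add: lookup_add scale_add_left sum.distrib)
qed

lemma lin_ext_scale: "lin_ext \<phi> (scale c f) = scale c (lin_ext \<phi> f)"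
proof -
  have "lin_ext \<phi> (scale c f) = (\<Sum>m\<in>monoms f. scale (coeff (scale c f) m) (\<phi> m))"
    by (rule lin_ext_superset) (auto simp: in_keys_iff coeff_scale)
  then show ?thesis
    by (simp add: coeff_scale scale_sum scale_scale lin_ext_def)
qed

lemma lin_ext_single: "lin_ext \<phi> (Poly_Mapping.single m c) = scale c (\<phi> m)"
  by (cases "c = 0") (simp_all add: lin_ext_def)

lemma mpoly_induct [case_names single add]:
  fixes f :: "('v, 'k::field) mpoly"
  assumes single: "\<And>m c. R (Poly_Mapping.single m c)"
    and add: "\<And>f g. R f \<Longrightarrow> R g \<Longrightarrow> R (f + g)"
  shows "R f"
proof (induction f rule: Poly_Mapping.update_induct)
  case const
  show ?case using single[of 0 0] by simp
next
  case (update f m c)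
  have "Poly_Mapping.update m c f = f + Poly_Mapping.single m c"
    using update(1)
    by (intro poly_mapping_eqI)
       (auto simp: lookup_update lookup_add lookup_single in_keys_iff when_def)
  then show ?case using add[OF update.IH single[of m c]] by simp
qed

lemma bilinear_ext:
  fixes B :: "('v, 'k::field) mpoly \<Rightarrow> ('v, 'k) mpoly \<Rightarrow> ('w, 'k) mpoly"
  assumes "\<And>f f' g. B (f + f') g = B f g + B f' g" "\<And>f g g'. B f (g + g') = B f g + B f g'"
    and "\<And>f f' g. C (f + f') g = C f g + C f' g" "\<And>f g g'. C f (g + g') = C f g + C f g'"
    and "\<And>l m c d. B (Poly_Mapping.single l c) (Poly_Mapping.single m d)
                   = C (Poly_Mapping.single l c) (Poly_Mapping.single m d)"
  shows "B f g = C f g"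
proof (induction f rule: mpoly_induct)
  case (single l c)
  show ?case by (induction g rule: mpoly_induct) (simp_all add: assms)
qed (simp add: assms)

lemma single_minus_add_nat:
  fixes l m :: "'v monomial"
  assumes "expo l v \<noteq> 0"
  shows "(l + m) - Poly_Mapping.single v 1 = (l - Poly_Mapping.single v 1) + m"
  by (rule poly_mapping_eqI) (use assms in \<open>auto simp: lookup_add lookup_minus lookup_single when_def\<close>)

lemma pderiv_monom_add:
  "pderiv_monom v (l + m) =
     pderiv_monom v l * Poly_Mapping.single m 1 + Poly_Mapping.single l 1 * pderiv_monom v m"
proof -
  have 1: "Poly_Mapping.single (l + m - Poly_Mapping.single v 1) (of_nat (expo l v))
      = pderiv_monom v l * Poly_Mapping.single m 1"
    by (cases "expo l v = 0") (simp_all add: pderiv_monom_def mult_single single_minus_add_nat[of l v m, simplified])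
  have 2: "Poly_Mapping.single (l + m - Poly_Mapping.single v 1) (of_nat (expo m v))
      = Poly_Mapping.single l 1 * pderiv_monom v m"
    by (cases "expo m v = 0")
       (simp_all add: pderiv_monom_def mult_single single_minus_add_nat[of m v l, simplified] add.commute[of l])
  show ?thesis
    unfolding 1[symmetric] 2[symmetric]
    by (simp add: pderiv_monom_def lookup_add single_add)
qed

lemma single_eq_scale: "Poly_Mapping.single m c = scale c (Poly_Mapping.single m 1)"
  by (simp add: scale_def mult_single)

lemma lin_ext_leibniz:
  assumes "\<And>l m. \<phi> (l + m) = \<phi> l * Poly_Mapping.single m 1 + Poly_Mapping.single l 1 * \<phi> m"
  shows "lin_ext \<phi> (f * g) = lin_ext \<phi> f * g + f * lin_ext \<phi> g"
proof (rule bilinear_ext[where B = "\<lambda>f g. lin_ext \<phi> (f * g)"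
      and C = "\<lambda>f g. lin_ext \<phi> f * g + f * lin_ext \<phi> g"], goal_cases)
  case (5 l m c d)
  have "Poly_Mapping.single (l + m) (c * d) =
      Poly_Mapping.single l c * Poly_Mapping.single m d" by (simp add: mult_single)
  show ?case
    unfolding mult_single lin_ext_single assms
    by (subst (3) single_eq_scale, subst (4) single_eq_scale)
       (simp add: scale_def mult_single algebra_simps flip: mult_single[of 0 c 0 d, simplified])
qed (simp_all add: lin_ext_add algebra_simps)

lemma var_neq_zero [simp]: "var v \<noteq> (0 :: ('v, 'k::field) mpoly)"
  by (metis one_neq_zero lookup_single_eq lookup_zero var_def)

lemma pd_add: "pd v (f + g) = pd v f + pd v g"
  by (simp add: pd_def lin_ext_add)

lemma pd_scale: "pd v (scale c f) = scale c (pd v f)"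
  by (simp add: pd_def lin_ext_scale)

lemma pd_var: "pd v (var w) = (if v = w then 1 else 0)"
  by (simp add: pd_def var_def lin_ext_single pderiv_monom_def lookup_single when_def)

lemma pd_mult: "pd v (f * g) = pd v f * g + f * pd v g"
  unfolding pd_def by (rule lin_ext_leibniz) (rule pderiv_monom_add)

lemma D_add: "D (f + g) = D f + D g"
  by (simp add: D_def lin_ext_add)

lemma D_scale: "D (scale c f) = scale c (D f)"
  by (simp add: D_def lin_ext_scale)

lemma D_var: "D (var (i, r)) = var (i, Suc r)"
  by (simp add: D_def var_def lin_ext_single D_monom_def pderiv_monom_def lookup_single mult_single)

lemma D_monom_superset:
  assumes "finite A" "vars m \<subseteq> A"
  shows "D_monom m = (\<Sum>v\<in>A. pderiv_monom v m * var (fst v, Suc (snd v)))"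
  unfolding D_monom_def
  by (rule sum.mono_neutral_left) (use assms in \<open>auto simp: in_keys_iff pderiv_monom_def\<close>)

lemma D_mult: "D (f * g) = D f * g + f * D g"
  unfolding D_def
proof (rule lin_ext_leibniz)
  fix l m :: "dvar monomial"
  let ?A = "vars l \<union> vars m"
  have "D_monom h = (\<Sum>v\<in>?A. pderiv_monom v h * (var (fst v, Suc (snd v)) :: (dvar, 'a) mpoly))"
    if "h \<in> {l, m, l + m}" for h
    by (rule D_monom_superset) (use that Poly_Mapping.keys_add[of l m] in auto)
  then show "(D_monom (l + m) :: (dvar, 'a) mpoly) =
      D_monom l * Poly_Mapping.single m 1 + Poly_Mapping.single l 1 * D_monom m"
    by (simp add: pderiv_monom_add sum_distrib_left sum_distrib_right algebra_simps
        flip: sum.distrib)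
qed

lemma D_diff: "D (f - g) = D f - D g"
  using D_add[of "f - g" g] by (simp add: algebra_simps)

lemma nov_left_symmetric:
  "(f \<circ>\<^sub>N g) \<circ>\<^sub>N h - f \<circ>\<^sub>N (g \<circ>\<^sub>N h) = (g \<circ>\<^sub>N f) \<circ>\<^sub>N h - g \<circ>\<^sub>N (f \<circ>\<^sub>N h)"
  by (simp add: nov_prod_def D_mult algebra_simps)

lemma nov_right_commutative: "(f \<circ>\<^sub>N g) \<circ>\<^sub>N h = (f \<circ>\<^sub>N h) \<circ>\<^sub>N g"
  by (simp add: nov_prod_def algebra_simps)

lemma lie_elements_subset_Nov: "lie_elements n \<subseteq> (Nov n :: (dvar, 'k::field) mpoly set)"
proof
  fix f :: "(dvar, 'k) mpoly"
  assume "f \<in> lie_elements n"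
  then show "f \<in> Nov n"
    unfolding lie_elements_def Nov_def
  proof induction
    case (mult f g)
    have "f \<circ>\<^sub>N g + scale (-1) (g \<circ>\<^sub>N f) \<in> subalgebra_gen (\<circ>\<^sub>N) (gens n)"
      by (intro subalgebra_gen.intros mult.IH)
    moreover have "scale (-1) (g \<circ>\<^sub>N f) = - (g \<circ>\<^sub>N f)"
      by (intro poly_mapping_eqI) (simp add: coeff_scale)
    ultimately show ?case by (simp add: nov_bracket_def)
  qed (auto intro: subalgebra_gen.intros)
qed

lemma symbol_add: "symbol (f + g) = symbol f + symbol g"
  by (simp add: symbol_def lin_ext_add)

lemma symbol_scale: "symbol (scale c f) = scale c (symbol f)"
  by (simp add: symbol_def lin_ext_scale)

lemma prod_var: "finite I \<Longrightarrow>
  (\<Prod>i\<in>I. (var (g i) :: ('v, 'k::field) mpoly)) = Poly_Mapping.single (\<Sum>i\<in>I. Poly_Mapping.single (g i) 1) 1"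
  by (induction I rule: finite_induct) (simp_all add: var_def mult_single)

lemma prod_var_power:
  assumes "finite I"
  shows "(\<Prod>i\<in>I. (var i :: ('v, 'k::field) mpoly) ^ a i) =
    Poly_Mapping.single (\<Sum>i\<in>I. Poly_Mapping.single i (a i)) 1"
proof -
  have "(var i :: ('v, 'k) mpoly) ^ r = Poly_Mapping.single (Poly_Mapping.single i r) 1" for i r
    by (induction r) (simp_all add: var_def mult_single flip: single_add)
  with assms show ?thesis
    by (induction I rule: finite_induct) (simp_all add: mult_single)
qed

lemma symbol_multilinear_monom:
  "symbol (\<Prod>i\<in>{1..n}. var (i, a i)) = (\<Prod>i\<in>{1..n}. (var i :: (nat, 'k::field) mpoly) ^ a i)"
proof -
  let ?m = "\<Sum>i\<in>{1..n}. Poly_Mapping.single (i, a i) (1::nat)"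
  have m: "expo ?m v = (if v \<in> (\<lambda>i. (i, a i)) ` {1..n} then 1 else 0)" for v
  proof -
    have "expo ?m v = (\<Sum>i\<in>{1..n}. if i = fst v then (if a i = snd v then 1 else 0) else 0)"
      unfolding lookup_sum
      by (rule sum.cong) (auto simp: lookup_single when_def prod_eq_iff)
    also have "\<dots> = (if v \<in> (\<lambda>i. (i, a i)) ` {1..n} then 1 else 0)"
      unfolding sum.delta[OF finite_atLeastAtMost]
      by (auto simp: image_iff prod_eq_iff)
    finally show ?thesis .
  qed
  then have "vars ?m = (\<lambda>i. (i, a i)) ` {1..n}"
    unfolding set_eq_iff in_keys_iff by auto
  moreover have "inj_on (\<lambda>i. (i, a i)) {1..n}" by (simp add: inj_on_def)
  ultimately have "symbol_monom ?m = (\<Sum>i\<in>{1..n}. Poly_Mapping.single i (a i))"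
    unfolding symbol_monom_def m by (simp add: sum.reindex)
  then show ?thesis
    by (simp add: prod_var prod_var_power symbol_def lin_ext_single)
qed

end

(* Multilinear Lie elements correspond to the polynomials "lie {1..n}" generated from constants by
   P * Q * (s_B - s_A), where s_A is the sum of the t_i with i in A.  The two equations say that P is
   killed by the vector fields z^2 d/dz and z^3 d/dz acting on n copies of the adjoint representation of
   the Witt algebra, hence by all z^(k+1) d/dz with k >= 1; call such P invariant of weight k if its
   degree is n - k.

   Invariants of weight k >= 1 are sums of products of k Lie words, by induction on the set of variables.
   The coefficient of the top power t_v^r is an invariant of weight k - 1 + r in the other variables.
   If k >= 2 it is a sum of products of k - 1 + r >= r + 1 Lie words u_j, and
   [..[x_v, u_1],.., u_r] u_(r+1) .. u_(k-1+r) has the same leading term up to sign.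
   If k = 1, the part of top degree T in t_v and t_w has coefficients that are invariant of weight T - 1,
   and the brackets [[x_v, u_1, .., u_i], [x_w, u_(i+1), .., u_(T-1)]] produce all leading terms
   (t_v - t_w) t_v^i t_w^(T-1-i) u_1 .. u_(T-1); if T = 1, the coefficient c has weight 0, but c x_w is a
   Lie element by induction and [x_v, c x_w] has leading term c (t_w - t_v).  Hence P is congruent modulo
   Lie elements to its image under the transposition of v and w, thus to its symmetrization, and
   symmetric invariants of positive degree vanish. *)

theory Submission
  imports Defs "HOL-Combinatorics.Permutations"
begin

section \<open>Derivations and vector fields\<close>

lemma coeff_pd: "coeff (pd v f) m = of_nat (Suc (expo m v)) * coeff f (m + Poly_Mapping.single v 1)"
proof (induction f rule: mpoly_induct)
  case (single l c)
  show ?case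
  proof (cases "expo l v = 0")
    case True
    then have "l \<noteq> m + Poly_Mapping.single v 1"
      by (auto simp: lookup_add)
    then show ?thesis
      using True by (simp add: pd_def lin_ext_single pderiv_monom_def lookup_single when_def)
  next
    case False
    then have "(l - Poly_Mapping.single v 1) + Poly_Mapping.single v 1 = l"
      by (intro poly_mapping_eqI) (auto simp: lookup_add lookup_minus lookup_single when_def)
    then have "l - Poly_Mapping.single v 1 = m \<longleftrightarrow> l = m + Poly_Mapping.single v 1"
      by (metis add_diff_cancel_right')
    moreover have "l = m + Poly_Mapping.single v 1 \<Longrightarrow> expo l v = Suc (expo m v)"
      by (simp add: lookup_add)
    ultimately show ?thesis
      by (auto simp: pd_def lin_ext_single pderiv_monom_def coeff_scale lookup_single when_def)
  qed
qed (simp add: pd_add lookup_add algebra_simps)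

lemma coeff_monom_mult_add:
  "coeff (Poly_Mapping.single a 1 * f) (a + m) = coeff (f :: ('v, 'k::field) mpoly) m"
  by (induction f rule: mpoly_induct)
     (auto simp: mult_single lookup_single when_def distrib_left lookup_add)

lemma monoms_monom_mult:
  assumes "m \<in> monoms (Poly_Mapping.single a 1 * (f :: ('v, 'k::field) mpoly))"
  obtains l where "m = a + l" "l \<in> monoms f"
proof -
  have "m \<in> {x + y |x y. x \<in> monoms (Poly_Mapping.single a (1::'k)) \<and> y \<in> monoms f}"
    using assms Poly_Mapping.keys_mult by blast
  then show ?thesis using that by auto
qed

lemma coeff_var_mult:
  "coeff (var v * f) m = (if expo m v = 0 then 0 else coeff f (m - Poly_Mapping.single v 1))"
proof (cases "expo m v = 0")
  case True
  have "m \<notin> monoms (var v * f)"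
    using True by (auto simp: var_def lookup_add elim!: monoms_monom_mult)
  then show ?thesis using True by (simp add: in_keys_iff)
next
  case False
  then have "Poly_Mapping.single v 1 + (m - Poly_Mapping.single v 1) = m"
    by (intro poly_mapping_eqI) (auto simp: lookup_add lookup_minus lookup_single when_def)
  then show ?thesis
    using False coeff_monom_mult_add[of "Poly_Mapping.single v 1" f "m - Poly_Mapping.single v 1"]
    by (simp add: var_def)
qed

lemma scale_minus_one: "scale (-1) f = - f"
  by (intro poly_mapping_eqI) (simp add: coeff_scale)

lemma scale_diff_right: "scale c (f - g) = scale c f - scale c g"
  by (simp add: scale_def algebra_simps)

lemma scale_mult_left: "scale c f * g = scale c (f * g)"
  by (simp add: scale_def algebra_simps)

lemma scale_mult_right: "f * scale c g = scale c (f * g)"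
  by (simp add: scale_def algebra_simps)

lemma scale_of_nat: "scale (of_nat k) f = of_nat k * f"
  by (simp add: scale_def single_of_nat)

lemma scale_inverse: "c \<noteq> 0 \<Longrightarrow> scale (inverse c) (scale c f) = f"
  by (simp add: scale_scale)

lemma pd_diff: "pd v (f - g) = pd v f - pd v g"
  using pd_add[of v "f - g" g] by (simp add: algebra_simps)

lemma pd_zero [simp]: "pd v 0 = 0"
  using pd_diff[of v 0 0] by simp

lemma pd_one [simp]: "pd v 1 = 0"
  using pd_mult[of v 1 1] by (simp del: pd_mult)

lemma pd_sum: "pd v (sum g A) = (\<Sum>a\<in>A. pd v (g a))"
  by (induction A rule: infinite_finite_induct) (simp_all add: pd_add)

lemma pd_of_nat_mult: "pd v (of_nat c * f) = of_nat c * pd v f"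
  by (metis pd_scale scale_of_nat)

lemma pd_of_nat [simp]: "pd v (of_nat c) = 0"
  using pd_of_nat_mult[of v c 1] by simp

lemma pd_commute: "pd v (pd w f) = pd w (pd v f)"
  by (rule poly_mapping_eqI) (auto simp: coeff_pd lookup_add lookup_single add_ac mult_ac when_def)

lemma pd_funpow_add: "(pd v ^^ k) (f + g) = (pd v ^^ k) f + (pd v ^^ k) g"
  by (induction k) (simp_all add: pd_add)

lemma pd_funpow_diff: "(pd v ^^ k) (f - g) = (pd v ^^ k) f - (pd v ^^ k) g"
  by (induction k) (simp_all add: pd_diff)

lemma pd_funpow_scale: "(pd v ^^ k) (scale c f) = scale c ((pd v ^^ k) f)"
  by (induction k) (simp_all add: pd_scale)

lemma pd_funpow_of_nat_mult: "(pd v ^^ k) (of_nat c * f) = of_nat c * (pd v ^^ k) f"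
  by (induction k) (simp_all add: pd_of_nat_mult)

lemma pd_funpow_commute: "(pd v ^^ k) (pd w f) = pd w ((pd v ^^ k) f)"
  by (induction k) (simp_all add: pd_commute[of w])

lemma pd_funpow_funpow_commute: "(pd v ^^ k) ((pd w ^^ l) f) = (pd w ^^ l) ((pd v ^^ k) f)"
  by (induction l) (simp_all add: pd_funpow_commute)

lemma pd_funpow_mult_const:
  assumes "pd v g = 0" shows "(pd v ^^ k) (f * g) = (pd v ^^ k) f * g"
  by (induction k) (simp_all add: pd_mult assms)

text \<open>Only two terms of the Leibniz formula survive, since the second derivative of
  \<open>var v\<close> is 0.\<close>

lemma pd_funpow_var_mult:
  "(pd v ^^ Suc k) (var v * f) = var v * (pd v ^^ Suc k) f + of_nat (Suc k) * (pd v ^^ k) f"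
proof (induction k)
  case (Suc k)
  show ?case
    unfolding funpow.simps(2)[of "Suc k"] comp_def Suc
    by (simp add: pd_mult pd_add pd_var distrib_right add_ac)
qed (simp add: pd_mult pd_var add.commute)

text \<open>The product is the rising factorial (e + 1) (e + 2) ... (e + k), where e is the exponent
  of v in m.\<close>

lemma coeff_pd_funpow:
  "coeff ((pd v ^^ k) f) m = of_nat (\<Prod>j<k. Suc (expo m v + j)) * coeff f (m + Poly_Mapping.single v k)"
proof (induction k arbitrary: m)
  case (Suc k)
  have *: "m + Poly_Mapping.single v 1 + Poly_Mapping.single v k = m + Poly_Mapping.single v (Suc k)"
    by (intro poly_mapping_eqI) (simp add: lookup_add lookup_single when_def)
  have "coeff ((pd v ^^ Suc k) f) m = of_nat (Suc (expo m v)) *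
     (of_nat (\<Prod>j<k. Suc (expo m v + Suc j)) * coeff f (m + Poly_Mapping.single v (Suc k)))"
    using * by (simp add: coeff_pd Suc lookup_add)
  then show ?case
    unfolding prod.lessThan_Suc_shift[of _ k] of_nat_mult by simp
qed simp

text \<open>Monomials are eigenvectors of the Euler operator. Hence \<open>var v * pd v f\<close>
  has no monomials beyond those of f, and \<open>witt 0\<close> can be computed on homogeneous
  polynomials.\<close>

lemma coeff_var_pd: "coeff (var v * pd v f) m = of_nat (expo m v) * coeff f m"
proof (cases "expo m v = 0")
  case False
  then have "m - Poly_Mapping.single v 1 + Poly_Mapping.single v 1 = m"
    by (intro poly_mapping_eqI) (auto simp: lookup_add lookup_minus lookup_single when_def)
  then show ?thesis using False by (simp add: coeff_var_mult coeff_pd lookup_minus)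
qed (simp add: coeff_var_mult)

section \<open>The Witt algebra acting on polynomials\<close>

text \<open>\<open>witt_at k i\<close> is the coadjoint action of \<open>z\<^sup>k\<^sup>+\<^sup>1 d/dz\<close>: on \<open>f d/dz\<close> the adjoint action is
  \<open>z\<^sup>k\<^sup>+\<^sup>1 f' - (k + 1) z\<^sup>k f\<close>, and on symbols \<open>d/dz\<close> becomes \<open>t\<^sub>i\<close> and \<open>z\<close> becomes
  \<open>\<partial>/\<partial>t\<^sub>i\<close>.\<close>

definition witt_at :: "nat \<Rightarrow> 'v \<Rightarrow> ('v, 'k::field) mpoly \<Rightarrow> ('v, 'k) mpoly" where
  "witt_at k i P = var i * (pd i ^^ Suc k) P - of_nat (Suc k) * (pd i ^^ k) P"

text \<open>The diagonal action on the variables indexed by S. The two operators of the theorem are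
  \<open>witt 1 {1..n}\<close> and \<open>witt 2 {1..n}\<close>.\<close>

definition witt :: "nat \<Rightarrow> 'v set \<Rightarrow> ('v, 'k::field) mpoly \<Rightarrow> ('v, 'k) mpoly" where
  "witt k S P = (\<Sum>i\<in>S. witt_at k i P)"

lemma witt_at_add: "witt_at k i (f + g) = witt_at k i f + witt_at k i g"
  unfolding witt_at_def pd_funpow_add by (simp add: algebra_simps)

lemma witt_at_scale: "witt_at k i (scale c f) = scale c (witt_at k i f)"
  unfolding witt_at_def pd_funpow_scale by (simp only: scale_diff_right scale_mult_right)

lemma witt_at_mult_const: "pd i g = 0 \<Longrightarrow> witt_at k i (f * g) = witt_at k i f * g"
  unfolding witt_at_def by (simp only: pd_funpow_mult_const) (simp add: algebra_simps)

lemma pd_funpow_zero [simp]: "(pd v ^^ k) 0 = 0"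
  by (induction k) simp_all

text \<open>Every term contains at least one derivative once k >= 1. For k = 0 the result would be -
  f, because of the second summand of \<open>witt_at\<close>.\<close>

lemma witt_at_const: "pd i f = 0 \<Longrightarrow> k \<ge> 1 \<Longrightarrow> witt_at k i f = 0"
  by (cases k) (simp_all add: witt_at_def funpow_Suc_right del: funpow.simps(2))

text \<open>The commutator of \<open>witt_at (Suc k) i\<close> with multiplication by
  \<open>var i\<close>. That multiplication plays the role of d/dz, and the bracket of z^(k+2) d/dz
  with d/dz is z^(k+1) d/dz times k + 2, up to sign.\<close>

lemma witt_at_var_mult_same: "witt_at (Suc k) i (var i * f) = var i * witt_at (Suc k) i f + of_nat (Suc (Suc k)) * witt_at k i f"
  unfolding witt_at_def pd_funpow_var_mult by (simp add: algebra_simps)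

lemma witt_at_commute: "i \<noteq> j \<Longrightarrow> witt_at k i (witt_at l j f) = witt_at l j (witt_at k i f)"
proof -
  assume "i \<noteq> j"
  have *: "(pd i ^^ a) (var j * g) = var j * (pd i ^^ a) g" "(pd j ^^ a) (var i * g) = var i * (pd j ^^ a) g" for a g
    using pd_funpow_mult_const[of i "var j" a g] pd_funpow_mult_const[of j "var i" a g] \<open>i \<noteq> j\<close>
    by (simp_all add: pd_var mult.commute)
  show ?thesis
    unfolding witt_at_def pd_funpow_diff pd_funpow_of_nat_mult *
      pd_funpow_funpow_commute[where v = j and w = i] by (simp only: algebra_simps)
qed

text \<open>The Witt algebra relation between z^2 d/dz and z^(k+1) d/dz. The hypothesis k >= 1 keeps
  the subtraction in \<open>of_nat (k - 1)\<close> from being truncated.\<close>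

lemma witt_at_commutator:
  assumes "k \<ge> 1"
  shows "witt_at 1 i (witt_at k i f) = witt_at k i (witt_at 1 i f) - of_nat (k - 1) * witt_at (Suc k) i f"
proof -
  obtain j where k: "k = Suc j" using assms by (cases k) auto
  define F where "F = (pd i ^^ j) f"
  have F: "(pd i ^^ j) (pd i f) = pd i F" "(pd i ^^ j) (pd i (pd i f)) = pd i (pd i F)"
    by (simp_all add: F_def pd_funpow_commute)
  show ?thesis
    unfolding k witt_at_def One_nat_def pd_funpow_diff pd_funpow_of_nat_mult pd_funpow_var_mult
    by (simp add: F F_def[symmetric] pd_mult pd_add pd_diff pd_var algebra_simps)
qed

lemma witt_at_zero [simp]: "witt_at k i 0 = 0"
  by (simp add: witt_at_def)

lemma witt_zero [simp]: "witt k S 0 = 0"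
  by (simp add: witt_def)

lemma witt_add: "witt k S (f + g) = witt k S f + witt k S g"
  by (simp add: witt_def witt_at_add sum.distrib)
lemma witt_scale: "witt k S (scale c f) = scale c (witt k S f)"
  by (simp add: witt_def witt_at_scale scale_sum)
lemma witt_diff: "witt k S (f - g) = witt k S f - witt k S g"
  using witt_add[of k S "f - g" g] by (simp add: algebra_simps)

lemma witt_mult_const: "(\<And>i. i \<in> S \<Longrightarrow> pd i g = 0) \<Longrightarrow> witt k S (f * g) = witt k S f * g"
  by (simp add: witt_def witt_at_mult_const sum_distrib_right)

lemma witt_union: "finite A \<Longrightarrow> finite B \<Longrightarrow> A \<inter> B = {} \<Longrightarrow> witt k (A \<union> B) f = witt k A f + witt k B f"
  by (simp add: witt_def sum.union_disjoint)

lemma witt_mult_disjoint: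
  assumes "finite A" "finite B" "A \<inter> B = {}" "\<And>i. i \<in> A \<Longrightarrow> pd i g = 0" "\<And>i. i \<in> B \<Longrightarrow> pd i f = 0"
  shows "witt k (A \<union> B) (f * g) = witt k A f * g + f * witt k B g"
  using assms witt_mult_const[of A g k f] witt_mult_const[of B f k g]
  by (simp add: witt_union mult.commute)

definition vsum :: "'v set \<Rightarrow> ('v, 'k::field) mpoly" where
  "vsum S = (\<Sum>i\<in>S. var i)"

text \<open>The summands of \<open>vsum S\<close> other than \<open>var i\<close> are constants for
  \<open>witt_at (Suc k) i\<close>, so each i contributes the commutator in one variable
  only.\<close>

lemma witt_vsum_mult:
  assumes "finite S"
  shows "witt (Suc k) S (vsum S * f) = vsum S * witt (Suc k) S f + of_nat (Suc (Suc k)) * witt k S f"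
proof -
  have "witt_at (Suc k) i (vsum S * f) = vsum S * witt_at (Suc k) i f + of_nat (Suc (Suc k)) * witt_at k i f" if "i \<in> S" for i
  proof -
    have S: "vsum S = var i + vsum (S - {i})" (is "_ = _ + ?s")
      using assms that by (simp add: vsum_def sum.remove)
    have "pd i (?s :: ('a, 'b) mpoly) = 0" by (auto simp: vsum_def pd_sum pd_var intro!: sum.neutral split: if_splits)
    then show ?thesis
      using witt_at_mult_const[of i ?s "Suc k" f]
      unfolding S distrib_right witt_at_add witt_at_var_mult_same by (simp add: algebra_simps)
  qed
  then show ?thesis by (simp add: witt_def sum.distrib sum_distrib_left)
qed

lemma witt_commutator:
  assumes "finite S" "k \<ge> 1"
  shows "witt 1 S (witt k S f) = witt k S (witt 1 S f) - of_nat (k - 1) * witt (Suc k) S f"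
proof -
  have witt_at_sum: "witt_at a i (sum g A) = (\<Sum>x\<in>A. witt_at a i (g x))" if "finite A" for a i A and g :: "'a \<Rightarrow> ('a, 'b) mpoly"
    using that by (induction A) (simp_all add: witt_at_add witt_at_zero)
  have "witt 1 S (witt k S f) - witt k S (witt 1 S f) = (\<Sum>i\<in>S. \<Sum>j\<in>S. witt_at 1 i (witt_at k j f) - witt_at k j (witt_at 1 i f))"
    unfolding witt_def witt_at_sum[OF assms(1)] sum_subtractf
    by (subst (2) sum.swap) simp
  \<comment> \<open>Operators at different variables commute, so only the diagonal of the double sum
    remains.\<close>
  also have "\<dots> = (\<Sum>i\<in>S. \<Sum>j\<in>S. if j = i then - (of_nat (k - 1) * witt_at (Suc k) i f) else 0)"
  proof (intro sum.cong refl)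
    fix i j
    show "witt_at 1 i (witt_at k j f) - witt_at k j (witt_at 1 i f) = (if j = i then - (of_nat (k - 1) * witt_at (Suc k) i f) else 0)"
      using assms(2) witt_at_commutator[of k i f] witt_at_commute[of i j 1 k f] by simp
  qed
  also have "\<dots> = - (of_nat (k - 1) * witt (Suc k) S f)"
    using assms(1) by (simp add: witt_def sum_distrib_left sum_negf)
  finally show ?thesis by (simp add: algebra_simps)
qed

text \<open>The commutator of \<open>witt 1\<close> and \<open>witt j\<close> is
  \<open>witt (Suc j)\<close> times - (j - 1). In characteristic 0 this factor is invertible for j
  >= 2, but it is 0 for j = 1; therefore the vanishing under \<open>witt 2\<close> has to be assumed
  as well.\<close>

lemma witt_vanish_all:
  fixes f :: "('v, 'k::field_char_0) mpoly"
  assumes "finite S" "witt 1 S f = 0" "witt 2 S f = 0" "k \<ge> 1"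
  shows "witt k S f = 0"
  using assms(4)
proof (induction k rule: nat_less_induct)
  case (1 k)
  consider "k = 1" | "k = 2" | j where "k = Suc j" "j \<ge> 2"
    using "1.prems" that(3)[of "k - 1"] by fastforce
  then show ?case
  proof cases
    case 3
    then have j: "witt j S f = 0" using 1 by simp
    have "j \<ge> 1" using 3 by simp
    from witt_commutator[OF assms(1) this, of f]
    have "scale (of_nat (j - 1)) (witt k S f) = 0"
      unfolding j assms(2) witt_zero 3(1)[symmetric] scale_of_nat by simp
    moreover have "(of_nat (j - 1) :: 'k) \<noteq> 0"
      using 3 by (simp only: of_nat_eq_0_iff)
    ultimately show ?thesis
      by (metis scale_inverse scale_zero(2))
  qed (use assms in auto)
qed

section \<open>Invariant polynomials\<close>

definition adeg :: "'v set \<Rightarrow> 'v monomial \<Rightarrow> nat" where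
  "adeg A m = (\<Sum>i\<in>A. expo m i)"

lemma adeg_add: "adeg A (l + m) = adeg A l + adeg A m"
  by (simp add: adeg_def lookup_add sum.distrib)

lemma mdegree_eq_adeg: "finite S \<Longrightarrow> vars m \<subseteq> S \<Longrightarrow> mdegree m = adeg S m"
  unfolding mdegree_def adeg_def by (rule sum.mono_neutral_left) (auto simp: in_keys_iff)

lemma mdegree_add: "mdegree (l + m) = mdegree l + mdegree m"
  using mdegree_eq_adeg[of "vars l \<union> vars m"] Poly_Mapping.keys_add[of l m]
  by (simp add: adeg_add)

lemma mdegree_single [simp]: "mdegree (Poly_Mapping.single v r) = r"
  by (simp add: mdegree_def)

lemma mdegree_zero [simp]: "mdegree 0 = 0"
  by (simp add: mdegree_def)

definition polys_in :: "'v set \<Rightarrow> ('v, 'k::field) mpoly \<Rightarrow> bool" where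
  "polys_in S f \<longleftrightarrow> (\<forall>m\<in>monoms f. vars m \<subseteq> S)"

lemma monoms_mult:
  assumes "m \<in> monoms (f * g)" obtains a b where "m = a + b" "a \<in> monoms f" "b \<in> monoms g"
  using assms Poly_Mapping.keys_mult[of f g] by blast

lemma vars_add [simp]: "vars (l + m) = vars l \<union> vars (m :: 'v monomial)"
  by (auto simp: in_keys_iff lookup_add)

lemma pd_polys_in: "polys_in S f \<Longrightarrow> i \<notin> S \<Longrightarrow> pd i f = 0"
proof (rule poly_mapping_eqI)
  fix m
  assume "polys_in S f" "i \<notin> S"
  moreover have "i \<in> vars (m + Poly_Mapping.single i 1)" by simp
  ultimately have "m + Poly_Mapping.single i 1 \<notin> monoms f"
    unfolding polys_in_def by blast
  then show "coeff (pd i f) m = coeff 0 m"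
    by (simp add: coeff_pd in_keys_iff)
qed

text \<open>The bound is strict, so that T = 0 forces f = 0 and an induction on T can strip off one
  leading part at a time.\<close>

definition lowdeg :: "'v set \<Rightarrow> nat \<Rightarrow> ('v, 'k::field) mpoly \<Rightarrow> bool" where
  "lowdeg A T f \<longleftrightarrow> (\<forall>m\<in>monoms f. adeg A m < T)"

lemma lowdeg_zero [simp]: "lowdeg A T 0"
  by (simp add: lowdeg_def)

lemma lowdeg_add: "lowdeg A T f \<Longrightarrow> lowdeg A T g \<Longrightarrow> lowdeg A T (f + g)"
  using Poly_Mapping.keys_add[of f g] by (auto simp: lowdeg_def)

lemma lowdeg_scale: "lowdeg A T f \<Longrightarrow> lowdeg A T (scale c f)"
  by (auto simp: lowdeg_def in_keys_iff coeff_scale)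

lemma lowdeg_uminus: "lowdeg A T f \<Longrightarrow> lowdeg A T (- f)"
  using lowdeg_scale[of A T f "-1"] by (simp add: scale_minus_one)

lemma lowdeg_diff: "lowdeg A T f \<Longrightarrow> lowdeg A T g \<Longrightarrow> lowdeg A T (f - g)"
  using lowdeg_add[of A T f "- g"] by (simp add: lowdeg_uminus)

lemma lowdeg_sum: "(\<And>i. i \<in> I \<Longrightarrow> lowdeg A T (f i)) \<Longrightarrow> lowdeg A T (sum f I)"
  by (induction I rule: infinite_finite_induct) (simp_all add: lowdeg_add)

lemma lowdeg_mult: "lowdeg A (Suc s) f \<Longrightarrow> lowdeg A t g \<Longrightarrow> lowdeg A (s + t) (f * g)"
  by (fastforce simp: lowdeg_def adeg_add elim!: monoms_mult)

lemma lowdeg_mult': "lowdeg A s f \<Longrightarrow> lowdeg A (Suc t) g \<Longrightarrow> lowdeg A (s + t) (f * g)"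
  using lowdeg_mult[of A t g s f] by (simp add: ac_simps)

lemma lowdeg_mono: "lowdeg A s f \<Longrightarrow> s \<le> t \<Longrightarrow> lowdeg A t f"
  by (force simp: lowdeg_def)

lemma adeg_disjoint: "vars m \<inter> A = {} \<Longrightarrow> adeg A m = 0"
  unfolding adeg_def by (rule sum.neutral) (auto simp: in_keys_iff)

lemma lowdeg_polys_in: "polys_in S f \<Longrightarrow> S \<inter> A = {} \<Longrightarrow> lowdeg A (Suc 0) f"
  unfolding lowdeg_def polys_in_def by (intro ballI) (simp, rule adeg_disjoint, blast)

lemma lowdeg_var: "finite A \<Longrightarrow> lowdeg A (Suc (Suc 0)) (var i)"
  by (simp add: lowdeg_def var_def adeg_def lookup_single when_def)

lemma lowdeg_vsum: "finite A \<Longrightarrow> lowdeg A (Suc (Suc 0)) (vsum S)"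
  unfolding vsum_def by (intro lowdeg_sum lowdeg_var)

lemma lowdeg_zero_iff: "lowdeg A 0 f \<longleftrightarrow> f = 0"
  by (auto simp: lowdeg_def)

lemma polys_in_zero [simp]: "polys_in S 0" by (simp add: polys_in_def)
lemma polys_in_one [simp]: "polys_in S 1" by (simp add: polys_in_def)

lemma polys_in_add: "polys_in S f \<Longrightarrow> polys_in S g \<Longrightarrow> polys_in S (f + g)"
  using Poly_Mapping.keys_add[of f g] unfolding polys_in_def by blast

lemma polys_in_scale: "polys_in S f \<Longrightarrow> polys_in S (scale c f)"
  by (auto simp: polys_in_def in_keys_iff coeff_scale)

lemma polys_in_diff: "polys_in S f \<Longrightarrow> polys_in S g \<Longrightarrow> polys_in S (f - g)"
  using polys_in_add[of S f "scale (-1) g"] polys_in_scale[of S g "-1"] by (simp add: scale_minus_one)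

lemma polys_in_mult: "polys_in S f \<Longrightarrow> polys_in S g \<Longrightarrow> polys_in S (f * g)"
  unfolding polys_in_def by (intro ballI) (force elim!: monoms_mult)

lemma polys_in_sum: "(\<And>i. i \<in> I \<Longrightarrow> polys_in S (f i)) \<Longrightarrow> polys_in S (sum f I)"
  by (induction I rule: infinite_finite_induct) (simp_all add: polys_in_add)

lemma polys_in_var: "i \<in> S \<Longrightarrow> polys_in S (var i)"
  by (simp add: polys_in_def var_def)

lemma polys_in_vsum: "polys_in S (vsum S)"
  unfolding vsum_def by (intro polys_in_sum polys_in_var)

section \<open>Leading parts and their coefficients\<close>

definition part :: "'v set \<Rightarrow> nat \<Rightarrow> ('v, 'k::field) mpoly \<Rightarrow> ('v, 'k) mpoly" where
  "part A T = lin_ext (\<lambda>m. if adeg A m = T then Poly_Mapping.single m 1 else 0)"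

lemma coeff_part: "coeff (part A T f) m = (if adeg A m = T then coeff f m else 0)"
  by (induction f rule: mpoly_induct)
     (auto simp: part_def lin_ext_single lin_ext_add lookup_add coeff_scale lookup_single when_def)

lemma lowdeg_diff_part: "lowdeg A (Suc T) f \<Longrightarrow> lowdeg A T (f - part A T f)"
  by (auto simp: lowdeg_def in_keys_iff lookup_minus coeff_part less_Suc_eq split: if_splits)

text \<open>The coefficient of the monomial a, for polynomials regarded as polynomials in the
  variables of A. It has this meaning only if \<open>vars a\<close> lies in A; then m - a involves
  no truncation.\<close>

definition slice :: "'v set \<Rightarrow> 'v monomial \<Rightarrow> ('v, 'k::field) mpoly \<Rightarrow> ('v, 'k) mpoly" where
  "slice A a = lin_ext (\<lambda>m. if \<forall>i\<in>A. expo m i = expo a i then Poly_Mapping.single (m - a) 1 else 0)"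

lemma slice_add: "slice A a (f + g) = slice A a f + slice A a g"
  by (simp add: slice_def lin_ext_add)

lemma slice_scale: "slice A a (scale c f) = scale c (slice A a f)"
  by (simp add: slice_def lin_ext_scale)

lemma slice_zero [simp]: "slice A a 0 = 0"
  using slice_scale[of A a 0 0] by simp

lemma slice_diff: "slice A a (f - g) = slice A a f - slice A a g"
  using slice_add[of A a "f - g" g] by (simp add: algebra_simps)

lemma slice_sum: "slice A a (sum f I) = (\<Sum>i\<in>I. slice A a (f i))"
  by (induction I rule: infinite_finite_induct) (simp_all add: slice_add)

lemma monom_diff_add:
  fixes a m :: "'v monomial"
  assumes "vars a \<subseteq> A" "\<forall>i\<in>A. expo m i = expo a i" shows "m - a + a = m"
proof (rule poly_mapping_eqI)
  fix i
  have "i \<notin> A \<Longrightarrow> expo a i = 0"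
    using assms(1) by (meson in_keys_iff subsetD)
  then show "expo (m - a + a) i = expo m i"
    using assms(2) by (cases "i \<in> A") (auto simp: lookup_add lookup_minus)
qed

lemma coeff_slice:
  assumes "vars a \<subseteq> A"
  shows "coeff (slice A a f) l = (if vars l \<inter> A = {} then coeff f (l + a) else 0)"
proof (induction f rule: mpoly_induct)
  case (single m c)
  show ?case
  proof (cases "\<forall>i\<in>A. expo m i = expo a i")
    case True
    have "vars (m - a) \<inter> A = {}" using True by (auto simp: in_keys_iff lookup_minus)
    moreover have "m - a + a = m" using monom_diff_add assms True by blast
    ultimately have "m - a = l \<longleftrightarrow> vars l \<inter> A = {} \<and> m = l + a"
      by (metis add_diff_cancel_right')
    then show ?thesis
      using True by (auto simp: slice_def lin_ext_single coeff_scale lookup_single when_def)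
  next
    case False
    then have "vars l \<inter> A = {} \<Longrightarrow> m \<noteq> l + a"
      by (auto simp: lookup_add in_keys_iff)
    then show ?thesis
      using False by (auto simp: slice_def lin_ext_single coeff_scale lookup_single when_def)
  qed
qed (simp add: slice_add lookup_add)

lemma slice_pd:
  assumes "vars a \<subseteq> A" "i \<notin> A"
  shows "slice A a (pd i f) = pd i (slice A a f)"
proof (rule poly_mapping_eqI)
  fix l
  have "expo a i = 0" using assms by (auto simp: in_keys_iff)
  then show "coeff (slice A a (pd i f)) l = coeff (pd i (slice A a f)) l"
    using assms(2) by (auto simp: coeff_slice[OF assms(1)] coeff_pd lookup_add add_ac)
qed

lemma slice_pd_funpow:
  "vars a \<subseteq> A \<Longrightarrow> i \<notin> A \<Longrightarrow> slice A a ((pd i ^^ k) f) = (pd i ^^ k) (slice A a f)"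
  by (induction k) (simp_all add: slice_pd)

lemma slice_var_mult:
  assumes "vars a \<subseteq> A" "i \<notin> A"
  shows "slice A a (var i * f) = var i * slice A a f"
proof (rule poly_mapping_eqI)
  fix l
  have a: "expo a i = 0" using assms by (auto simp: in_keys_iff)
  have "expo l i \<noteq> 0 \<Longrightarrow> l + a - Poly_Mapping.single i 1 = l - Poly_Mapping.single i 1 + a"
    by (rule single_minus_add_nat)
  moreover have "vars (l - Poly_Mapping.single i 1) \<inter> A = {} \<longleftrightarrow> vars l \<inter> A = {}"
  proof -
    have "expo (l - Poly_Mapping.single i 1) x = expo l x" if "x \<in> A" for x
      using assms(2) that by (auto simp: lookup_minus lookup_single when_def)
    then show ?thesis unfolding disjoint_iff in_keys_iff by metis
  qed
  ultimately show "coeff (slice A a (var i * f)) l = coeff (var i * slice A a f) l"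
    using a by (auto simp: coeff_slice[OF assms(1)] coeff_var_mult lookup_add)
qed

text \<open>The operators at variables outside A change no exponent inside A, so they act on each
  coefficient separately.\<close>

lemma slice_witt:
  assumes "vars a \<subseteq> A" "S \<inter> A = {}"
  shows "slice A a (witt k S f) = witt k S (slice A a f)"
proof -
  have "slice A a (witt_at k i f) = witt_at k i (slice A a f)" if "i \<in> S" for i
  proof -
    have "i \<notin> A" using that assms(2) by auto
    then show ?thesis
      unfolding witt_at_def scale_of_nat[symmetric]
      by (simp only: slice_diff slice_scale slice_var_mult[OF assms(1) \<open>i \<notin> A\<close>]
          slice_pd_funpow[OF assms(1) \<open>i \<notin> A\<close>])
  qed
  then show ?thesis by (simp add: witt_def slice_sum)
qed

text \<open>The set I lists the monomials of degree T in the variables of A.\<close>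

lemma part_eq_sum_slices:
  assumes "finite I" "\<And>a. a \<in> I \<Longrightarrow> vars a \<subseteq> A \<and> adeg A a = T"
    and ex: "\<And>m :: 'v monomial. adeg A m = T \<Longrightarrow> \<exists>a\<in>I. \<forall>i\<in>A. expo m i = expo a i"
  shows "part A T f = (\<Sum>a\<in>I. Poly_Mapping.single a 1 * slice A a f)"
proof (induction f rule: mpoly_induct)
  case (single m c)
  have *: "Poly_Mapping.single a 1 * slice A a (Poly_Mapping.single m c) =
      (if \<forall>i\<in>A. expo m i = expo a i then Poly_Mapping.single m c else 0)" if "a \<in> I" for a
    using monom_diff_add[of a A m] assms(2)[OF that]
    by (auto simp: slice_def lin_ext_single scale_def mult_single add.commute)
  show ?case
  proof (cases "adeg A m = T")
    case True
    then obtain b where b: "b \<in> I" "\<forall>i\<in>A. expo m i = expo b i" using ex by blast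
    \<comment> \<open>A monomial supported in A is determined by its exponents on A, so exactly one
      summand is nonzero.\<close>
    have "(\<forall>i\<in>A. expo m i = expo a i) \<longleftrightarrow> a = b" if "a \<in> I" for a
    proof
      assume a: "\<forall>i\<in>A. expo m i = expo a i"
      show "a = b"
      proof (rule poly_mapping_eqI)
        fix i
        have "i \<notin> A \<Longrightarrow> expo a i = 0 \<and> expo b i = 0"
          using assms(2)[OF that] assms(2)[OF b(1)] by (meson in_keys_iff subsetD)
        then show "expo a i = expo b i"
          using a b(2) by (cases "i \<in> A") auto
      qed
    qed (use b in simp)
    then have "(\<Sum>a\<in>I. Poly_Mapping.single a 1 * slice A a (Poly_Mapping.single m c))
       = (\<Sum>a\<in>I. if a = b then Poly_Mapping.single m c else 0)"
      by (intro sum.cong) (simp_all add: *)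
    then show ?thesis
      using True b(1) assms(1) by (simp add: part_def lin_ext_single scale_def mult_single)
  next
    case False
    have no: "\<not> (\<forall>i\<in>A. expo m i = expo a i)" if "a \<in> I" for a
    proof
      assume "\<forall>i\<in>A. expo m i = expo a i"
      then have "adeg A m = adeg A a" by (simp add: adeg_def)
      then show False using False assms(2)[OF that] by simp
    qed
    then have "(\<Sum>a\<in>I. Poly_Mapping.single a 1 * slice A a (Poly_Mapping.single m c)) = 0"
      using * no by (intro sum.neutral ballI) metis
    then show ?thesis
      using False by (simp add: part_def lin_ext_single)
  qed
next
  case (add f g)
  then show ?case
    by (simp add: part_def lin_ext_add slice_add distrib_left sum.distrib)
qed

lemma lowdeg_pd: "lowdeg A T f \<Longrightarrow> lowdeg A T (pd i f)"
proof -
  assume f: "lowdeg A T f"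
  have "adeg A m < T" if "m \<in> monoms (pd i f)" for m
  proof -
    have "m + Poly_Mapping.single i 1 \<in> monoms f"
      using that by (auto simp: in_keys_iff coeff_pd)
    then have "adeg A (m + Poly_Mapping.single i 1) < T" using f by (simp add: lowdeg_def)
    then show ?thesis by (simp add: adeg_add)
  qed
  then show ?thesis by (simp add: lowdeg_def)
qed

lemma lowdeg_pd_mem: "finite A \<Longrightarrow> i \<in> A \<Longrightarrow> lowdeg A (Suc T) f \<Longrightarrow> lowdeg A T (pd i f)"
proof -
  assume f: "lowdeg A (Suc T) f" and A: "finite A" "i \<in> A"
  have "adeg A m < T" if "m \<in> monoms (pd i f)" for m
  proof -
    have "m + Poly_Mapping.single i 1 \<in> monoms f"
      using that by (auto simp: in_keys_iff coeff_pd)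
    then have "adeg A (m + Poly_Mapping.single i 1) < Suc T" using f unfolding lowdeg_def by blast
    moreover have "adeg A (Poly_Mapping.single i 1) = 1"
      using A by (simp add: adeg_def lookup_single when_def)
    ultimately show ?thesis by (simp add: adeg_add)
  qed
  then show ?thesis by (simp add: lowdeg_def)
qed

lemma lowdeg_pd_funpow: "lowdeg A T f \<Longrightarrow> lowdeg A T ((pd i ^^ k) f)"
  by (induction k) (simp_all add: lowdeg_pd)

lemma lowdeg_var_pd: "lowdeg A T f \<Longrightarrow> lowdeg A T (var i * pd i f)"
  by (auto simp: lowdeg_def in_keys_iff coeff_var_pd)

text \<open>Since k >= 1, \<open>pd i ^^ k\<close> lowers the degree in A at least once, and the
  Euler operator \<open>var i * pd i\<close> does not raise it again.\<close>

lemma lowdeg_witt_at: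
  assumes "finite A" "i \<in> A" "k \<ge> 1" "lowdeg A (Suc T) f"
  shows "lowdeg A T (witt_at k i f)"
proof -
  obtain j where k: "k = Suc j" using assms(3) by (cases k) auto
  have 1: "lowdeg A T ((pd i ^^ k) f)"
    unfolding k using assms by (simp add: lowdeg_pd_mem lowdeg_pd_funpow)
  then have "lowdeg A T (var i * pd i ((pd i ^^ k) f))" by (rule lowdeg_var_pd)
  moreover have "lowdeg A T (of_nat (Suc k) * (pd i ^^ k) f)"
    using 1 by (simp only: scale_of_nat[symmetric] lowdeg_scale)
  ultimately show ?thesis unfolding witt_at_def funpow.simps comp_def by (rule lowdeg_diff)
qed

lemma lowdeg_witt: "finite A \<Longrightarrow> k \<ge> 1 \<Longrightarrow> lowdeg A (Suc T) f \<Longrightarrow> lowdeg A T (witt k A f)"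
  unfolding witt_def by (intro lowdeg_sum lowdeg_witt_at) auto

lemma slice_lowdeg: "vars a \<subseteq> A \<Longrightarrow> lowdeg A (adeg A a) f \<Longrightarrow> slice A a f = 0"
proof (rule poly_mapping_eqI)
  fix l
  assume a: "vars a \<subseteq> A" "lowdeg A (adeg A a) f"
  have "l + a \<notin> monoms f"
    using a(2) by (auto simp: lowdeg_def adeg_add)
  then show "coeff (slice A a f) l = coeff 0 l"
    using a by (simp add: coeff_slice in_keys_iff)
qed

text \<open>The degree \<open>card S - k\<close> is expressed by a sum to avoid truncated
  subtraction; only 0 qualifies if k exceeds \<open>card S\<close>. With all j >= 1 in the
  definition, the closure properties below hold over every field.\<close>

definition invariant :: "'v set \<Rightarrow> nat \<Rightarrow> ('v, 'k::field) mpoly \<Rightarrow> bool" where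
  "invariant S k f \<longleftrightarrow> (\<forall>m\<in>monoms f. vars m \<subseteq> S \<and> mdegree m + k = card S) \<and> (\<forall>j\<ge>1. witt j S f = 0)"

lemma invariant_polys_in: "invariant S k f \<Longrightarrow> polys_in S f"
  by (simp add: invariant_def polys_in_def)

lemma invariant_zero [simp]: "invariant S k 0"
  by (simp add: invariant_def)

lemma invariant_add: "invariant S k f \<Longrightarrow> invariant S k g \<Longrightarrow> invariant S k (f + g)"
  using Poly_Mapping.keys_add[of f g] unfolding invariant_def witt_add by (metis (no_types, lifting) UnE add_0 subsetD)

lemma invariant_scale: "invariant S k f \<Longrightarrow> invariant S k (scale c f)"
  by (auto simp: invariant_def witt_scale in_keys_iff coeff_scale)

lemma invariant_diff: "invariant S k f \<Longrightarrow> invariant S k g \<Longrightarrow> invariant S k (f - g)"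
  using invariant_add[of S k f "scale (-1) g"] invariant_scale[of S k g "-1"] by (simp add: scale_minus_one)

lemma invariant_sum: "(\<And>i. i \<in> I \<Longrightarrow> invariant S k (f i)) \<Longrightarrow> invariant S k (sum f I)"
  by (induction I rule: infinite_finite_induct) (simp_all add: invariant_add)

text \<open>The operator \<open>witt 0 S\<close> is the Euler operator minus \<open>card S\<close>,
  hence a scalar on polynomials that are homogeneous in the variables of S; for degree
  \<open>card S - k\<close> the scalar is - k.\<close>

lemma witt_zero_invariant:
  assumes "finite S" "invariant S k f"
  shows "witt 0 S f = - (of_nat k * f)"
proof (rule poly_mapping_eqI)
  fix m
  have "coeff (witt 0 S f) m = (\<Sum>i\<in>S. (of_nat (expo m i) - 1) * coeff f m)"
    by (simp add: witt_def witt_at_def lookup_sum lookup_minus coeff_var_pd algebra_simps)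
  also have "\<dots> = (of_nat (adeg S m) - of_nat (card S)) * coeff f m"
    by (simp add: adeg_def sum_subtractf sum_distrib_right[symmetric])
  also have "\<dots> = - of_nat k * coeff f m"
  proof (cases "m \<in> monoms f")
    case True
    then have "mdegree m + k = card S" "vars m \<subseteq> S" using assms(2) by (auto simp: invariant_def)
    then have "card S = adeg S m + k" using assms(1) by (simp add: mdegree_eq_adeg)
    then show ?thesis by simp
  qed (simp add: in_keys_iff)
  also have "\<dots> = coeff (- (of_nat k * f)) m"
    by (simp add: scale_of_nat[symmetric] coeff_scale)
  finally show "coeff (witt 0 S f) m = coeff (- (of_nat k * f)) m" .
qed

lemma invariant_mult:
  assumes "finite A" "finite B" "A \<inter> B = {}" "invariant A k f" "invariant B l g"
  shows "invariant (A \<union> B) (k + l) (f * g)"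
proof -
  have "witt j (A \<union> B) (f * g) = witt j A f * g + f * witt j B g" for j
    using assms by (intro witt_mult_disjoint) (auto intro: pd_polys_in[OF invariant_polys_in])
  moreover have "vars m \<subseteq> A \<union> B \<and> mdegree m + (k + l) = card (A \<union> B)" if "m \<in> monoms (f * g)" for m
  proof -
    obtain a b where m: "m = a + b" "a \<in> monoms f" "b \<in> monoms g" using \<open>m \<in> _\<close> by (rule monoms_mult)
    then have "vars a \<subseteq> A" "mdegree a + k = card A" "vars b \<subseteq> B" "mdegree b + l = card B"
      using assms by (auto simp: invariant_def)
    then show ?thesis using assms(1-3) m(1) by (auto simp: card_Un_disjoint mdegree_add)
  qed
  ultimately show ?thesis using assms by (simp add: invariant_def)
qed

text \<open>Applying \<open>witt (Suc j)\<close> leaves only the commutators with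
  \<open>vsum B\<close> and \<open>vsum A\<close>, a multiple of the difference of
  \<open>f * witt j B g\<close> and \<open>witt j A f * g\<close>.\<close>

lemma invariant_bracket:
  assumes "finite A" "finite B" "A \<inter> B = {}" "invariant A 1 f" "invariant B 1 g"
  shows "invariant (A \<union> B) 1 (f * g * (vsum B - vsum A))"
proof -
  have pA: "pd i f = 0" "pd i (vsum A) = 0" if "i \<in> B" for i
    using that assms by (auto intro: pd_polys_in[OF invariant_polys_in] pd_polys_in[OF polys_in_vsum])
  have pB: "pd i g = 0" "pd i (vsum B) = 0" if "i \<in> A" for i
    using that assms by (auto intro: pd_polys_in[OF invariant_polys_in] pd_polys_in[OF polys_in_vsum])
  have "witt (Suc j) (A \<union> B) (f * g * (vsum B - vsum A)) = 0" for j
  proof -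
    have 0: "witt (Suc j) A f = 0" "witt (Suc j) B g = 0" using assms by (simp_all add: invariant_def)
    \<comment> \<open>For j = 0 both sides are - f g because both weights are 1; for j >= 1 both are
      0.\<close>
    have 1: "f * witt j B g = witt j A f * g"
    proof (cases j)
      case 0
      then show ?thesis using witt_zero_invariant[OF assms(1,4)] witt_zero_invariant[OF assms(2,5)] by simp
    qed (use assms in \<open>simp add: invariant_def\<close>)
    have "f * g * (vsum B - vsum A) = f * (vsum B * g) - (vsum A * f) * g" by (simp add: algebra_simps)
    moreover have "witt (Suc j) (A \<union> B) (f * (vsum B * g)) = witt (Suc j) A f * (vsum B * g) + f * witt (Suc j) B (vsum B * g)"
      using assms(1-3) by (intro witt_mult_disjoint) (simp_all add: pA pB pd_mult)
    moreover have "witt (Suc j) (A \<union> B) ((vsum A * f) * g) = witt (Suc j) A (vsum A * f) * g + (vsum A * f) * witt (Suc j) B g"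
      using assms(1-3) by (intro witt_mult_disjoint) (simp_all add: pA pB pd_mult)
    ultimately have "witt (Suc j) (A \<union> B) (f * g * (vsum B - vsum A)) =
        f * (of_nat (Suc (Suc j)) * witt j B g) - of_nat (Suc (Suc j)) * witt j A f * g"
      by (simp only: witt_diff witt_vsum_mult[OF assms(1)] witt_vsum_mult[OF assms(2)] 0) simp
    also have "\<dots> = of_nat (Suc (Suc j)) * (f * witt j B g - witt j A f * g)"
      by (simp only: algebra_simps)
    finally show ?thesis using 1 by simp
  qed
  then have "witt j (A \<union> B) (f * g * (vsum B - vsum A)) = 0" if "j \<ge> 1" for j
    using that by (cases j) auto
  moreover have "vars m \<subseteq> A \<union> B \<and> mdegree m + 1 = card (A \<union> B)" if m0: "m \<in> monoms (f * g * (vsum B - vsum A))" for m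
  proof -
    obtain c e where m: "m = c + e" "c \<in> monoms (f * g)" "e \<in> monoms (vsum B - vsum A :: ('a, 'b) mpoly)" using m0 by (rule monoms_mult)
    have "monoms (vsum B - vsum A :: ('a, 'b) mpoly) \<subseteq> (\<lambda>i. Poly_Mapping.single i 1) ` (A \<union> B)"
    proof
      fix e assume "e \<in> monoms (vsum B - vsum A :: ('a, 'b) mpoly)"
      then have "coeff (vsum B :: ('a, 'b) mpoly) e \<noteq> 0 \<or> coeff (vsum A :: ('a, 'b) mpoly) e \<noteq> 0"
        by (auto simp: in_keys_iff lookup_minus)
      then have "\<exists>i\<in>A \<union> B. coeff (var i :: ('a, 'b) mpoly) e \<noteq> 0"
        unfolding vsum_def lookup_sum by (meson UnI1 UnI2 sum.neutral)
      then show "e \<in> (\<lambda>i. Poly_Mapping.single i 1) ` (A \<union> B)"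
        by (auto simp: var_def lookup_single when_def split: if_splits)
    qed
    then obtain i where i: "i \<in> A \<union> B" "e = Poly_Mapping.single i 1" using m by blast
    have "vars c \<subseteq> A \<union> B \<and> mdegree c + (1 + 1) = card (A \<union> B)"
      using invariant_mult[OF assms] m(2) by (simp add: invariant_def)
    then show ?thesis using i m(1) by (auto simp: mdegree_add)
  qed
  ultimately show ?thesis by (simp add: invariant_def)
qed

text \<open>The constant 1 in the single new variable is an invariant of weight 1, and weights add
  in products.\<close>

lemma invariant_insert:
  assumes "finite S" "w \<notin> S" "invariant S k f"
  shows "invariant (insert w S) (Suc k) f"
proof -
  have "invariant {w} 1 1"
    by (simp add: invariant_def witt_def witt_at_const)
  then have "invariant ({w} \<union> S) (1 + k) (1 * f)"
    using assms by (intro invariant_mult) auto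
  then show ?thesis by simp
qed

text \<open>In \<open>witt j S f = 0\<close> the operators at variables of A only produce terms of
  degree below T in A, which \<open>slice A a\<close> removes; what remains is the equation for the
  coefficient. Its degree is that of f minus T, in \<open>card A\<close> fewer variables, which
  gives the weight k + T - \<open>card A\<close>.\<close>

lemma invariant_slice:
  assumes "finite S" "A \<subseteq> S" "invariant S k f" "lowdeg A (Suc T) f" "vars a \<subseteq> A" "adeg A a = T"
    and k: "k' + card A = k + T"
  shows "invariant (S - A) k' (slice A a f)"
proof -
  have A: "finite A" using assms by (blast intro: finite_subset)
  have "witt j (S - A) (slice A a f) = 0" if "j \<ge> 1" for j
  proof -
    have "witt j (A \<union> (S - A)) f = witt j A f + witt j (S - A) f"
      using assms A by (intro witt_union) auto
    then have "0 = slice A a (witt j A f + witt j (S - A) f)"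
      using assms that by (simp add: invariant_def Un_absorb1)
    also have "\<dots> = witt j (S - A) (slice A a f)"
      using assms(5) slice_lowdeg[OF assms(5), of "witt j A f"] lowdeg_witt[OF A that assms(4)]
      by (subst slice_add, subst (2) slice_witt) (auto simp: assms(6))
    finally show ?thesis by simp
  qed
  moreover have "vars l \<subseteq> S - A \<and> mdegree l + k' = card (S - A)" if "l \<in> monoms (slice A a f)" for l
  proof -
    have l: "vars l \<inter> A = {}" "l + a \<in> monoms f"
      using that assms(5) by (auto simp: in_keys_iff coeff_slice split: if_splits)
    have "vars (l + a) \<subseteq> S" "mdegree (l + a) + k = card S"
      using assms(3) l(2) unfolding invariant_def by blast+
    moreover have "mdegree a = T" using assms(5,6) A by (simp add: mdegree_eq_adeg)
    moreover have "card (S - A) = card S - card A" "card A \<le> card S"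
      using assms A by (simp_all add: card_Diff_subset card_mono)
    moreover have "vars l \<subseteq> vars (l + a)" by simp
    ultimately show ?thesis using l(1) k unfolding mdegree_add by (intro conjI) (blast, linarith)
  qed
  ultimately show ?thesis by (simp add: invariant_def)
qed

section \<open>Permutations of variables and Lie polynomials\<close>

lemma lin_ext_mult_hom:
  assumes "\<And>l m. \<phi> (l + m) = \<phi> l * \<phi> m"
  shows "lin_ext \<phi> (f * g) = lin_ext \<phi> f * lin_ext \<phi> g"
  by (rule bilinear_ext[where B = "\<lambda>f g. lin_ext \<phi> (f * g)" and C = "\<lambda>f g. lin_ext \<phi> f * lin_ext \<phi> g"])
     (simp_all add: lin_ext_add algebra_simps mult_single lin_ext_single assms scale_mult_left scale_mult_right scale_scale)

lemma lookup_map_key: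
  "inj p \<Longrightarrow> Poly_Mapping.lookup (Poly_Mapping.map_key p m) i = Poly_Mapping.lookup m (p i)"
  by (simp add: Poly_Mapping.map_key.rep_eq)

text \<open>A right action: \<open>t\<^sub>i\<close> goes to \<open>t\<^sub>j\<close> with \<open>p j = i\<close>. Only meaningful for injective \<open>p\<close>.\<close>

definition act :: "('v \<Rightarrow> 'v) \<Rightarrow> ('v, 'k::field) mpoly \<Rightarrow> ('v, 'k) mpoly" where
  "act p = lin_ext (\<lambda>m. Poly_Mapping.single (Poly_Mapping.map_key p m) 1)"

lemma act_add: "act p (f + g) = act p f + act p g"
  by (simp add: act_def lin_ext_add)

lemma act_scale: "act p (scale c f) = scale c (act p f)"
  by (simp add: act_def lin_ext_scale)

lemma act_zero [simp]: "act p 0 = 0"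
  using act_scale[of p 0 0] by simp

lemma act_diff: "act p (f - g) = act p f - act p g"
  using act_add[of p "f - g" g] by (simp add: algebra_simps)

lemma act_sum: "act p (sum f I) = (\<Sum>i\<in>I. act p (f i))"
  by (induction I rule: infinite_finite_induct) (simp_all add: act_add)

lemma act_mult: "inj p \<Longrightarrow> act p (f * g) = act p f * act p g"
  unfolding act_def by (rule lin_ext_mult_hom) (simp add: Poly_Mapping.map_key_plus mult_single)

lemma map_key_inv:
  assumes "bij p"
  shows "Poly_Mapping.map_key (inv p) (Poly_Mapping.map_key p m) = m"
    and "Poly_Mapping.map_key p (Poly_Mapping.map_key (inv p) m) = m"
proof -
  have p: "inj p" "inj (inv p)" using assms by (simp_all add: bij_is_inj bij_imp_bij_inv)
  show "Poly_Mapping.map_key (inv p) (Poly_Mapping.map_key p m) = m"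
    by (rule poly_mapping_eqI) (simp add: p lookup_map_key surj_f_inv_f[OF bij_is_surj[OF assms]])
  show "Poly_Mapping.map_key p (Poly_Mapping.map_key (inv p) m) = m"
    by (rule poly_mapping_eqI) (simp add: p lookup_map_key inv_f_f)
qed

lemma coeff_act: "bij p \<Longrightarrow> coeff (act p f) m = coeff f (Poly_Mapping.map_key (inv p) m)"
proof (induction f rule: mpoly_induct)
  case (single l c)
  then have "Poly_Mapping.map_key p l = m \<longleftrightarrow> l = Poly_Mapping.map_key (inv p) m"
    using map_key_inv by metis
  then show ?case
    by (simp add: act_def lin_ext_single coeff_scale lookup_single when_def)
qed (simp add: act_add lookup_add)

lemma map_key_single_bij:
  "bij p \<Longrightarrow> Poly_Mapping.map_key p (Poly_Mapping.single i c) = Poly_Mapping.single (inv p i) c"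
  using Poly_Mapping.map_key_single[of p "inv p i" c] by (simp add: bij_is_inj surj_f_inv_f bij_is_surj)

lemma act_var: "bij p \<Longrightarrow> act p (var i) = var (inv p i)"
  by (simp add: act_def var_def lin_ext_single map_key_single_bij)

lemma act_one [simp]: "inj p \<Longrightarrow> act p 1 = 1"
  using lin_ext_single[of "\<lambda>m. Poly_Mapping.single (Poly_Mapping.map_key p m) 1" 0 1] by (simp add: act_def)

lemma act_vsum: "bij p \<Longrightarrow> act p (vsum S) = vsum (p -` S)"
  by (simp add: vsum_def act_sum act_var bij_vimage_eq_inv_image sum.reindex inj_on_subset[OF bij_is_inj[OF bij_imp_bij_inv]])

lemma act_pd:
  assumes "bij p" shows "act p (pd i f) = pd (inv p i) (act p f)"
proof (rule poly_mapping_eqI)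
  fix m
  have "Poly_Mapping.map_key (inv p) (Poly_Mapping.single (inv p i) 1) = Poly_Mapping.single i (1::nat)"
    using map_key_single_bij[OF bij_imp_bij_inv[OF assms], of "inv p i" "1::nat"] assms
    by (simp add: inv_inv_eq surj_f_inv_f bij_is_surj)
  then show "coeff (act p (pd i f)) m = coeff (pd (inv p i) (act p f)) m"
    using assms bij_imp_bij_inv[OF assms]
    by (simp add: coeff_act coeff_pd lookup_map_key bij_is_inj Poly_Mapping.map_key_plus del: One_nat_def)
qed

lemma act_pd_funpow: "bij p \<Longrightarrow> act p ((pd i ^^ k) f) = (pd (inv p i) ^^ k) (act p f)"
  by (induction k) (simp_all add: act_pd)

lemma act_witt:
  assumes "bij p" shows "act p (witt k S f) = witt k (p -` S) (act p f)"
proof -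
  have "act p (witt_at k i f) = witt_at k (inv p i) (act p f)" for i
    unfolding witt_at_def scale_of_nat[symmetric]
    by (simp only: act_diff act_scale act_mult[OF bij_is_inj[OF assms]] act_var[OF assms] act_pd_funpow[OF assms])
  then show ?thesis
    using assms by (simp add: witt_def act_sum bij_vimage_eq_inv_image sum.reindex inj_on_subset[OF bij_is_inj[OF bij_imp_bij_inv]])
qed

lemma monoms_act:
  assumes "bij p" "m \<in> monoms (act p f)"
  obtains l where "l \<in> monoms f" "m = Poly_Mapping.map_key p l"
  using assms that[of "Poly_Mapping.map_key (inv p) m"] map_key_inv(2)[of p m]
  by (simp add: in_keys_iff coeff_act)

lemma act_act: "bij p \<Longrightarrow> bij q \<Longrightarrow> act p (act q f) = act (q \<circ> p) f"
proof (rule poly_mapping_eqI)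
  fix m assume "bij p" "bij q"
  then have "inj (inv p)" "inj (inv q)" by (simp_all add: bij_is_inj bij_imp_bij_inv)
  with \<open>bij p\<close> \<open>bij q\<close> show "coeff (act p (act q f)) m = coeff (act (q \<circ> p) f) m"
    using Poly_Mapping.map_key_compose[of "inv q" "inv p" m]
    by (simp add: coeff_act bij_comp o_inv_distrib)
qed

lemma act_id [simp]: "act id f = f"
proof (rule poly_mapping_eqI)
  fix m show "coeff (act id f) m = coeff f m"
    using coeff_act[of id f m] Poly_Mapping.map_key_id[of m] by (simp add: id_def[symmetric])
qed

lemma invariant_act:
  assumes "finite S" "p permutes S" "invariant S k f"
  shows "invariant S k (act p f)"
proof -
  have p: "bij p" "inj p" "p -` S = S"
    using assms(2) by (auto simp: permutes_bij permutes_inj permutes_vimage)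
  have "vars m \<subseteq> S \<and> mdegree m + k = card S" if m: "m \<in> monoms (act p f)" for m
  proof -
    obtain l where l: "l \<in> monoms f" "m = Poly_Mapping.map_key p l" using monoms_act[OF p(1) m] .
    then have "vars l \<subseteq> S" "mdegree l + k = card S" using assms(3) by (auto simp: invariant_def)
    moreover from this have m: "vars m \<subseteq> S" using p(3) by (auto simp: l(2) Poly_Mapping.keys_map_key[OF p(2)])
    moreover have "(\<Sum>i\<in>S. expo l (p i)) = (\<Sum>i\<in>S. expo l i)"
      using sum.permute[OF assms(2), of "expo l"] by (simp add: o_def)
    ultimately show ?thesis
      using assms(1) by (simp add: mdegree_eq_adeg adeg_def l(2) lookup_map_key[OF p(2)])
  qed
  moreover have "witt j S (act p f) = 0" if "j \<ge> 1" for j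
    using act_witt[OF p(1), of j S f] p(3) that assms(3) by (simp add: invariant_def)
  ultimately show ?thesis by (simp add: invariant_def)
qed

text \<open>These turn out to be the symbols of Lie elements multilinear in the variables of S. The
  rule \<open>bracket\<close> is the image of \<open>nov_bracket\<close>, because \<open>D\<close>
  acts on the symbol of an element multilinear in B as multiplication by
  \<open>vsum B\<close>.\<close>

inductive lie :: "'v set \<Rightarrow> ('v, 'k::field) mpoly \<Rightarrow> bool" where
  unit: "lie {i} 1"
| zero: "finite S \<Longrightarrow> lie S 0"
| add: "lie S f \<Longrightarrow> lie S g \<Longrightarrow> lie S (f + g)"
| scale: "lie S f \<Longrightarrow> lie S (scale c f)"
| bracket: "lie A f \<Longrightarrow> lie B g \<Longrightarrow> A \<inter> B = {} \<Longrightarrow> lie (A \<union> B) (f * g * (vsum B - vsum A))"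

text \<open>Sums of products of k Lie polynomials whose variable sets partition S: the image of a
  multilinear part of the free Poisson algebra. Factors are added one at a time, so that an
  induction peels off a single Lie factor.\<close>

inductive pois :: "'v set \<Rightarrow> nat \<Rightarrow> ('v, 'k::field) mpoly \<Rightarrow> bool" where
  unit: "pois {} 0 1"
| zero: "finite S \<Longrightarrow> pois S k 0"
| add: "pois S k f \<Longrightarrow> pois S k g \<Longrightarrow> pois S k (f + g)"
| scale: "pois S k f \<Longrightarrow> pois S k (scale c f)"
| mult: "lie A f \<Longrightarrow> pois B k g \<Longrightarrow> A \<inter> B = {} \<Longrightarrow> pois (A \<union> B) (Suc k) (f * g)"

lemma lie_finite: "lie S f \<Longrightarrow> finite S"
  by (induction rule: lie.induct) auto

lemma pois_finite: "pois S k f \<Longrightarrow> finite S"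
  by (induction rule: pois.induct) (auto simp: lie_finite)

lemma lie_uminus: "lie S f \<Longrightarrow> lie S (- f)"
  using lie.scale[of S f "-1"] by (simp add: scale_minus_one)

lemma lie_diff: "lie S f \<Longrightarrow> lie S g \<Longrightarrow> lie S (f - g)"
  using lie.add[of S f "- g"] by (simp add: lie_uminus)

lemma lie_sum: "finite S \<Longrightarrow> (\<And>i. i \<in> I \<Longrightarrow> lie S (f i)) \<Longrightarrow> lie S (sum f I)"
  by (induction I rule: infinite_finite_induct) (simp_all add: lie.zero lie.add)

lemma invariant_one: "invariant {i} (Suc 0) 1"
  by (simp add: invariant_def witt_def witt_at_const)

text \<open>The necessity of the differential equations, on the level of symbols;
  \<open>invariant_bracket\<close> provides the only case with content.\<close>

lemma lie_invariant: "lie S f \<Longrightarrow> invariant S 1 f"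
proof (induction rule: lie.induct)
  case (bracket A f B g)
  then show ?case by (intro invariant_bracket) (auto intro: lie_finite)
qed (auto simp: invariant_one invariant_add invariant_scale)

lemma pois_invariant: "pois S k f \<Longrightarrow> invariant S k f"
proof (induction rule: pois.induct)
  case (mult A f B k g)
  then have "invariant (A \<union> B) (1 + k) (f * g)"
    using lie_invariant[OF mult.hyps(1)]
    by (intro invariant_mult) (auto intro: lie_finite pois_finite)
  then show ?case by simp
qed (auto simp: invariant_add invariant_scale, auto simp: invariant_def witt_def)

lemma lie_act:
  assumes "bij p" shows "lie S f \<Longrightarrow> lie (p -` S) (act p f)"
proof (induction rule: lie.induct)
  case (unit i)
  have "p -` {i} = {inv p i}" using assms by (auto simp: bij_vimage_eq_inv_image)
  then show ?case using assms by (simp add: bij_is_inj lie.unit)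
next
  case (bracket A f B g)
  have "lie (p -` A \<union> p -` B) (act p f * act p g * (vsum (p -` B) - vsum (p -` A)))"
    using bracket by (intro lie.bracket) auto
  then show ?case using assms by (simp add: act_mult act_diff act_vsum bij_is_inj)
qed (use assms in \<open>auto simp: act_add act_scale bij_is_inj finite_vimageI intro: lie.intros\<close>)

lemma pois_0: "pois S k f \<Longrightarrow> k = 0 \<Longrightarrow> f = 0 \<or> (S = {} \<and> (\<exists>c. f = scale c 1))"
proof (induction rule: pois.induct)
  case unit
  then show ?case by (metis scale_one)
next
  case (add S k f g)
  then show ?case by (auto simp flip: scale_add_left)
next
  case (scale S k f c)
  then show ?case by (auto simp: scale_scale)
qed auto

text \<open>Behind the one Lie factor stands a product of no factors, which is 0 or a scalar on the
  empty set.\<close>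

lemma pois_1: "pois S k f \<Longrightarrow> k = 1 \<Longrightarrow> lie S f"
proof (induction rule: pois.induct)
  case (mult A f B k g)
  consider "g = 0" | c where "B = {}" "g = scale c 1" using pois_0[OF mult.hyps(2)] mult.prems by auto
  then show ?case
  proof cases
    case 1
    then show ?thesis using mult.hyps by (simp add: lie.zero lie_finite pois_finite)
  next
    case 2
    then show ?thesis using mult.hyps(1) by (simp add: scale_mult_right lie.scale)
  qed
qed (auto intro: lie.intros)

lemma lie_polys_in: "lie S f \<Longrightarrow> polys_in S f"
  by (rule invariant_polys_in[OF lie_invariant])

text \<open>Here f stands for the part of degree T of h in the variables of A. It may contain lower
  terms, or no term of degree T at all, which makes the relation stable under sums.\<close>

definition leads :: "'v set \<Rightarrow> nat \<Rightarrow> ('v, 'k::field) mpoly \<Rightarrow> ('v, 'k) mpoly \<Rightarrow> bool" where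
  "leads A T h f \<longleftrightarrow> lowdeg A (Suc T) f \<and> lowdeg A T (h - f)"

lemma leads_refl: "polys_in S f \<Longrightarrow> S \<inter> A = {} \<Longrightarrow> leads A 0 f f"
  by (simp add: leads_def lowdeg_polys_in)

text \<open>In h j - f g = (h - f) j + f (j - g) each summand has one factor of smaller degree than
  expected.\<close>

lemma leads_mult:
  assumes "leads A s h f" "leads A t j g"
  shows "leads A (s + t) (h * j) (f * g)"
proof -
  have "lowdeg A (Suc t) j"
    using lowdeg_add[of A "Suc t" "j - g" g] lowdeg_mono[of A t "j - g" "Suc t"] assms(2)
    by (simp add: leads_def)
  moreover have "h * j - f * g = (h - f) * j + f * (j - g)" by (simp add: algebra_simps)
  ultimately show ?thesis
    using assms lowdeg_mult[of A s f t "j - g"] lowdeg_mult'[of A s "h - f" t j]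
      lowdeg_mult[of A s f "Suc t" g]
    by (simp add: leads_def lowdeg_add)
qed

lemma leads_add: "leads A T h f \<Longrightarrow> leads A T j g \<Longrightarrow> leads A T (h + j) (f + g)"
  using lowdeg_add[of A T "h - f" "j - g"] by (simp add: leads_def lowdeg_add algebra_simps)

lemma leads_scale: "leads A T h f \<Longrightarrow> leads A T (scale c h) (scale c f)"
  using lowdeg_scale[of A T "h - f" c] by (simp add: leads_def lowdeg_scale scale_diff_right)

text \<open>Variables outside A have degree 0 in A, so only those in A contribute to the leading
  part of the linear factor of a bracket.\<close>

lemma leads_vsum:
  fixes A S B :: "'v set"
  assumes "finite A" "finite S" "finite B"
  shows "leads A 1 (vsum S - vsum B :: ('v, 'k::field) mpoly) (vsum (S \<inter> A) - vsum (B \<inter> A))"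
proof -
  have *: "(vsum S :: ('v, 'k) mpoly) = vsum (S \<inter> A) + vsum (S - A)" if "finite S" for S
    using that by (simp add: vsum_def sum.Int_Diff)
  have eq: "(vsum S :: ('v, 'k) mpoly) - vsum B - (vsum (S \<inter> A) - vsum (B \<inter> A)) = vsum (S - A) - vsum (B - A)"
    using *[OF assms(2)] *[OF assms(3)] by (simp add: algebra_simps)
  have "lowdeg A (Suc 0) (vsum (S - A) - vsum (B - A) :: ('v, 'k) mpoly)"
    by (intro lowdeg_diff lowdeg_polys_in[OF polys_in_vsum]) auto
  then show ?thesis
    unfolding leads_def eq using assms(1) by (simp add: lowdeg_vsum lowdeg_diff)
qed

section \<open>Leading terms\<close>

lemma leads_zero: "leads A T 0 0"
  by (simp add: leads_def)

text \<open>Bracketing f with s of the r Lie factors of c multiplies the leading term by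
  \<open>var v\<close> each time; the other r - s factors stay factors beside the bracket. The
  statement is for a general f, since each bracket formed replaces f in the rest of the
  induction.\<close>

lemma pois_leading:
  assumes "pois B r c"
  shows "\<lbrakk>lie S f; S \<inter> B = {}; v \<in> S; v \<notin> B; leads {v} a f g; s \<le> r\<rbrakk>
    \<Longrightarrow> \<exists>h. pois (S \<union> B) (Suc r - s) h \<and> leads {v} (a + s) h (var v ^ s * g * c)"
  using assms
proof (induction arbitrary: S f a g s rule: pois.induct)
  case unit
  then show ?case using pois.mult[OF unit(1) pois.unit] by (intro exI[of _ f]) simp
next
  case (zero B r)
  then show ?case by (intro exI[of _ 0]) (auto simp: leads_zero lie_finite intro: pois.zero)
next
  case (add B r c c')
  obtain h where h: "pois (S \<union> B) (Suc r - s) h" "leads {v} (a + s) h (var v ^ s * g * c)"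
    using add.IH(1)[OF add.prems] by blast
  obtain h' where h': "pois (S \<union> B) (Suc r - s) h'" "leads {v} (a + s) h' (var v ^ s * g * c')"
    using add.IH(2)[OF add.prems] by blast
  show ?case
    using pois.add[OF h(1) h'(1)] leads_add[OF h(2) h'(2)]
    by (intro exI[of _ "h + h'"]) (simp add: distrib_left)
next
  case (scale B r c x)
  obtain h where h: "pois (S \<union> B) (Suc r - s) h" "leads {v} (a + s) h (var v ^ s * g * c)"
    using scale.IH[OF scale.prems] by blast
  show ?case
    using pois.scale[OF h(1), of x] leads_scale[OF h(2), of x]
    by (intro exI[of _ "scale x h"]) (simp add: scale_mult_right)
next
  case (mult A u B r c)
  have u: "leads {v} 0 u u" using mult.prems mult.hyps(1) by (intro leads_refl[OF lie_polys_in]) auto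
  show ?case
  proof (cases "s \<le> r")
    case True
    obtain h where h: "pois (S \<union> B) (Suc r - s) h" "leads {v} (a + s) h (var v ^ s * g * c)"
      using mult.IH[OF mult.prems(1), of a g s] mult.prems True by auto
    have "pois (A \<union> (S \<union> B)) (Suc (Suc r - s)) (u * h)"
      using mult.prems mult.hyps h by (intro pois.mult) auto
    moreover have "Suc (Suc r - s) = Suc (Suc r) - s" "A \<union> (S \<union> B) = S \<union> (A \<union> B)" using True by auto
    moreover have "leads {v} (a + s) (u * h) (var v ^ s * g * (u * c))"
      using leads_mult[OF u h(2)] by (simp add: ac_simps)
    ultimately show ?thesis by (intro exI[of _ "u * h"]) simp
  next
    case False
    then have s: "s = Suc r" using mult.prems by simp
    \<comment> \<open>Here all factors must be absorbed, u included. As v lies in S and not in A,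
      the new linear factor has leading term \<open>var v\<close>.\<close>
    let ?f = "u * f * (vsum S - vsum A)"
    have "lie (A \<union> S) ?f" using mult.prems mult.hyps by (intro lie.bracket) auto
    moreover have "leads {v} (0 + a + 1) ?f (u * g * (vsum (S \<inter> {v}) - vsum (A \<inter> {v})))"
      using mult.prems mult.hyps by (intro leads_mult u leads_vsum) (auto intro: lie_finite)
    moreover have "S \<inter> {v} = {v}" "A \<inter> {v} = {}" using mult.prems by auto
    ultimately obtain h where h: "pois ((A \<union> S) \<union> B) (Suc r - r) h"
      "leads {v} (0 + a + 1 + r) h (var v ^ r * (u * g * (vsum {v} - vsum {})) * c)"
      using mult.IH[of "A \<union> S" ?f "0 + a + 1" "u * g * (vsum {v} - vsum {})" r] mult.prems mult.hyps by auto
    have "var v ^ r * (u * g * (vsum {v} - vsum {})) * c = var v ^ s * g * (u * c)"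
      by (simp add: s vsum_def ac_simps)
    then show ?thesis using h by (intro exI[of _ h]) (simp add: s Un_ac)
  qed
qed

text \<open>Of the r Lie factors of c, i are bracketed onto f and j onto f'; the bracket of the two
  results then contributes \<open>var v - var w\<close>. As all factors are absorbed, the result is
  a single Lie polynomial.\<close>

lemma lie_leading:
  assumes "pois B r c" "v \<noteq> w"
  shows "\<lbrakk>lie S f; lie S' f'; S \<inter> S' = {}; S \<inter> B = {}; S' \<inter> B = {}; v \<in> S; w \<in> S';
      leads {v, w} a f g; leads {v, w} a' f' g'; i + j = r\<rbrakk>
    \<Longrightarrow> \<exists>h. lie (S \<union> S' \<union> B) h \<and>
      leads {v, w} (a + a' + r + 1) h (var v ^ i * var w ^ j * (var v - var w) * (g * g' * c))"
  using assms(1)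
proof (induction arbitrary: S f a g i S' f' a' g' j rule: pois.induct)
  case unit
  \<comment> \<open>The order of f' and f is chosen so that the sign is that of
    \<open>var v - var w\<close>.\<close>
  have "leads {v, w} (a' + a + 1) (f' * f * (vsum S - vsum S')) (g' * g * (vsum (S \<inter> {v, w}) - vsum (S' \<inter> {v, w})))"
    using unit by (intro leads_mult leads_vsum) (auto intro: lie_finite)
  moreover have "S \<inter> {v, w} = {v}" "S' \<inter> {v, w} = {w}" using unit by auto
  moreover have "lie (S' \<union> S) (f' * f * (vsum S - vsum S'))"
    using unit by (intro lie.bracket) auto
  ultimately show ?case
    using unit by (intro exI[of _ "f' * f * (vsum S - vsum S')"]) (simp add: vsum_def ac_simps Un_commute)
next
  case (zero B r)
  then show ?case by (intro exI[of _ 0]) (auto simp: leads_zero lie_finite intro: lie.zero)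
next
  case (add B r c c')
  let ?e = "var v ^ i * var w ^ j * (var v - var w)"
  obtain h where h: "lie (S \<union> S' \<union> B) h" "leads {v, w} (a + a' + r + 1) h (?e * (g * g' * c))"
    using add.IH(1)[OF add.prems] by blast
  obtain h' where h': "lie (S \<union> S' \<union> B) h'" "leads {v, w} (a + a' + r + 1) h' (?e * (g * g' * c'))"
    using add.IH(2)[OF add.prems] by blast
  show ?case
    using lie.add[OF h(1) h'(1)] leads_add[OF h(2) h'(2)]
    by (intro exI[of _ "h + h'"]) (simp add: distrib_left)
next
  case (scale B r c x)
  let ?e = "var v ^ i * var w ^ j * (var v - var w)"
  obtain h where h: "lie (S \<union> S' \<union> B) h" "leads {v, w} (a + a' + r + 1) h (?e * (g * g' * c))"
    using scale.IH[OF scale.prems] by blast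
  show ?case
    using lie.scale[OF h(1), of x] leads_scale[OF h(2), of x]
    by (intro exI[of _ "scale x h"]) (simp add: scale_mult_right)
next
  case (mult A u B r c)
  have vw: "v \<notin> A" "w \<notin> A" "w \<notin> S" "v \<notin> S'" using mult.prems by auto
  have u: "leads {v, w} 0 u u" using vw mult.hyps(1) by (intro leads_refl[OF lie_polys_in]) auto
  show ?case
  \<comment> \<open>The factor u goes onto f as long as i > 0. Once i = 0, all remaining factors go
    onto f', so j is r + 1 there.\<close>
  proof (cases i)
    case (Suc i')
    let ?f = "u * f * (vsum S - vsum A)"
    have d: "(A \<union> S) \<inter> S' = {}" "(A \<union> S) \<inter> B = {}" "S' \<inter> B = {}"
      using mult.prems mult.hyps by blast+
    have 1: "lie (A \<union> S) ?f" using mult.prems mult.hyps by (intro lie.bracket) auto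
    have "leads {v, w} (0 + a + 1) ?f (u * g * (vsum (S \<inter> {v, w}) - vsum (A \<inter> {v, w})))"
      using mult.prems mult.hyps by (intro leads_mult u leads_vsum) (auto intro: lie_finite)
    moreover have "S \<inter> {v, w} = {v}" "A \<inter> {v, w} = {}" using mult.prems vw by auto
    ultimately have 2: "leads {v, w} (a + 1) ?f (u * g * var v)" by (simp add: vsum_def)
    obtain h where h: "lie (A \<union> S \<union> S' \<union> B) h"
      "leads {v, w} (a + 1 + a' + r + 1) h (var v ^ i' * var w ^ j * (var v - var w) * (u * g * var v * g' * c))"
      using mult.IH[OF 1 mult.prems(2) d _ _ 2 mult.prems(9), of i' j] mult.prems Suc by auto
    have "var v ^ i' * var w ^ j * (var v - var w) * (u * g * var v * g' * c)
        = var v ^ i * var w ^ j * (var v - var w) * (g * g' * (u * c))"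
      unfolding Suc power_Suc by (simp only: ac_simps)
    moreover have "A \<union> S \<union> S' \<union> B = S \<union> S' \<union> (A \<union> B)" by auto
    ultimately show ?thesis using h by (intro exI[of _ h]) (simp add: ac_simps)
  next
    case 0
    let ?f = "u * f' * (vsum S' - vsum A)"
    have d: "S \<inter> (A \<union> S') = {}" "S \<inter> B = {}" "(A \<union> S') \<inter> B = {}"
      using mult.prems mult.hyps by blast+
    have 1: "lie (A \<union> S') ?f" using mult.prems mult.hyps by (intro lie.bracket) auto
    have "leads {v, w} (0 + a' + 1) ?f (u * g' * (vsum (S' \<inter> {v, w}) - vsum (A \<inter> {v, w})))"
      using mult.prems mult.hyps by (intro leads_mult u leads_vsum) (auto intro: lie_finite)
    moreover have "S' \<inter> {v, w} = {w}" "A \<inter> {v, w} = {}" using mult.prems vw by auto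
    ultimately have 2: "leads {v, w} (a' + 1) ?f (u * g' * var w)" by (simp add: vsum_def)
    obtain h where h: "lie (S \<union> (A \<union> S') \<union> B) h"
      "leads {v, w} (a + (a' + 1) + r + 1) h (var v ^ 0 * var w ^ r * (var v - var w) * (g * (u * g' * var w) * c))"
      using mult.IH[OF mult.prems(1) 1 d _ _ mult.prems(8) 2, of 0 r] mult.prems by auto
    have "var v ^ 0 * var w ^ r * (var v - var w) * (g * (u * g' * var w) * c)
        = var v ^ i * var w ^ j * (var v - var w) * (g * g' * (u * c))"
      using 0 mult.prems(10) by (simp add: ac_simps)
    moreover have "S \<union> (A \<union> S') \<union> B = S \<union> S' \<union> (A \<union> B)" by auto
    ultimately show ?thesis using h by (intro exI[of _ h]) (simp add: ac_simps)
  qed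
qed

lemma single_eq_power: "Poly_Mapping.single (Poly_Mapping.single v r) 1 = var v ^ r"
  by (rule prod_var_power[of "{v}" "\<lambda>_. r", symmetric, simplified])

lemma lowdeg_of_leads: "leads A T h g \<Longrightarrow> lowdeg A T (f - g) \<Longrightarrow> lowdeg A T (f - h)"
  using lowdeg_diff[of A T "f - g" "h - g"] by (simp add: leads_def)

text \<open>Descent on the degree in v: a combination of products of k Lie polynomials with the same
  leading part is subtracted, and the difference is again an invariant of weight k.\<close>

lemma invariant_pois_step:
  fixes f :: "('v, 'k::field) mpoly"
  assumes "finite S" "v \<in> S" "k \<ge> 2"
    and IH: "\<And>l c. invariant (S - {v}) l c \<Longrightarrow> l \<ge> 1 \<Longrightarrow> pois (S - {v}) l (c :: ('v, 'k) mpoly)"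
  shows "invariant S k f \<Longrightarrow> lowdeg {v} T f \<Longrightarrow> pois S k f"
proof (induction T arbitrary: f)
  case 0
  then show ?case using assms(1) by (simp add: lowdeg_zero_iff pois.zero)
next
  case (Suc T)
  let ?a = "Poly_Mapping.single v T"
  define c where "c = slice {v} ?a f"
  have a: "vars ?a \<subseteq> {v}" "adeg {v} ?a = T" by (simp_all add: adeg_def)
  have part: "part {v} T f = var v ^ T * c"
    using a by (subst part_eq_sum_slices[of "{?a}"]) (auto simp: adeg_def single_eq_power c_def)
  have "invariant (S - {v}) (k + T - 1) c"
    unfolding c_def by (rule invariant_slice[OF assms(1) _ Suc.prems a]) (use assms in auto)
  \<comment> \<open>The assumption k >= 2 enters at T = 0, where the coefficient has weight k - 1:
    the induction hypothesis covers only positive weights.\<close>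
  then have "pois (S - {v}) (k + T - 1) c" by (rule IH) (use assms(3) in linarith)
  moreover have "T \<le> k + T - 1" using assms(3) by linarith
  ultimately obtain h where h: "pois ({v} \<union> (S - {v})) (Suc (k + T - 1) - T) h"
    "leads {v} (0 + T) h (var v ^ T * 1 * c)"
    using pois_leading[OF _ lie.unit[of v] _ _ _ leads_refl[OF polys_in_one[of "{}"]],
        where B = "S - {v}" and r = "k + T - 1" and c = c and s = T]
    by auto
  moreover have "{v} \<union> (S - {v}) = S" "Suc (k + T - 1) - T = k" using assms(2,3) by auto
  ultimately have h: "pois S k h" "leads {v} T h (var v ^ T * c)" by simp_all
  have "lowdeg {v} T (f - h)"
    using lowdeg_of_leads[OF h(2)] lowdeg_diff_part[OF Suc.prems(2)] part by simp
  with invariant_diff[OF Suc.prems(1) pois_invariant[OF h(1)]]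
  have "pois S k (f - h)" by (rule Suc.IH)
  from pois.add[OF this h(1)] show ?case by simp
qed

section \<open>Transpositions and leading parts in two variables\<close>

lemma act_power: "inj p \<Longrightarrow> act p (f ^ r) = act p f ^ r"
  by (induction r) (simp_all add: act_mult)

lemma act_fixed:
  assumes "bij p" "\<And>i. i \<in> S \<Longrightarrow> p i = i" "polys_in S f"
  shows "act p f = f"
proof -
  have "Poly_Mapping.map_key p m = Poly_Mapping.map_key id m" if "m \<in> monoms f" for m
  proof (rule poly_mapping_eqI)
    fix i
    have m: "vars m \<subseteq> S" using assms(3) that by (auto simp: polys_in_def)
    show "expo (Poly_Mapping.map_key p m) i = expo (Poly_Mapping.map_key id m) i"
    proof (cases "i \<in> S")
      case False
      then have "p i \<notin> S" using assms(1,2) by (metis bij_is_inj inj_eq)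
      then have "expo m (p i) = 0" "expo m i = 0" using m False by (meson in_keys_iff subsetD)+
      then show ?thesis using assms(1) by (simp add: lookup_map_key bij_is_inj)
    qed (use assms in \<open>simp add: lookup_map_key bij_is_inj\<close>)
  qed
  then have "act p f = act id f" by (simp add: act_def lin_ext_def)
  then show ?thesis by simp
qed

lemma lowdeg_act:
  assumes "p permutes A" "lowdeg A T f" shows "lowdeg A T (act p f)"
  unfolding lowdeg_def
proof
  fix m assume "m \<in> monoms (act p f)"
  then obtain l where "l \<in> monoms f" "m = Poly_Mapping.map_key p l"
    using monoms_act permutes_bij[OF assms(1)] by blast
  moreover have "(\<Sum>i\<in>A. expo l (p i)) = (\<Sum>i\<in>A. expo l i)" for l
    using sum.permute[OF assms(1), of "expo l"] by (simp add: o_def)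
  ultimately show "adeg A m < T"
    using assms by (simp add: lowdeg_def adeg_def lookup_map_key permutes_inj)
qed

lemma polys_in_slice: "vars a \<subseteq> A \<Longrightarrow> polys_in S f \<Longrightarrow> polys_in (S - A) (slice A a f)"
  unfolding polys_in_def
proof
  fix l assume "vars a \<subseteq> A" "\<forall>m\<in>monoms f. vars m \<subseteq> S" "l \<in> monoms (slice A a f)"
  then have "vars l \<inter> A = {}" "vars (l + a) \<subseteq> S"
    by (auto simp: in_keys_iff[of _ "slice A a f"] in_keys_iff[of _ f] coeff_slice simp del: vars_add split: if_splits)
  then show "vars l \<subseteq> S - A" by auto
qed

text \<open>The part of degree T in v and w agrees with its transpose up to a Lie polynomial and
  terms of lower degree, since powers of v and w can be exchanged one at a time.\<close>

lemma transpose_congruent_step: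
  fixes f :: "('v, 'k::field_char_0) mpoly"
  assumes S: "finite S" and vw: "v \<in> S" "w \<in> S" "v \<noteq> w"
    and IH: "\<And>S' l c. S' \<subset> S \<Longrightarrow> invariant S' l c \<Longrightarrow> l \<ge> 1 \<Longrightarrow> pois S' l (c :: ('v, 'k) mpoly)"
    and f: "invariant S 1 f" "lowdeg {v, w} (Suc T) f"
  shows "\<exists>h. lie S h \<and> lowdeg {v, w} T (f - act (Transposition.transpose v w) f - h)"
proof -
  let ?A = "{v, w}" and ?p = "Transposition.transpose v w"
  \<comment> \<open>The terms of the leading part are the \<open>F r r\<close>; in
    \<open>F r i\<close> the coefficient \<open>c r\<close> is kept, but its monomial in v and w is
    replaced by the one with exponents i and T - i. \<open>Z\<close> collects the polynomials that
    are Lie modulo degree below T in v and w.\<close>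
  define a where "a = (\<lambda>r. Poly_Mapping.single v r + Poly_Mapping.single w (T - r))"
  define c where "c = (\<lambda>r. slice ?A (a r) f)"
  define F where "F = (\<lambda>r i. var v ^ i * var w ^ (T - i) * c r)"
  define Z where "Z = (\<lambda>g :: ('v, 'k) mpoly. \<exists>h. lie S h \<and> lowdeg ?A T (g - h))"
  have a: "vars (a r) \<subseteq> ?A" "r \<le> T \<Longrightarrow> adeg ?A (a r) = T" for r
    using vw(3) by (auto simp: a_def adeg_def lookup_add lookup_single when_def split: if_splits)
  have p: "bij ?p" "inj ?p" "?p -` S = S" "?p permutes ?A"
    using vw by (auto simp: permutes_swap_id permutes_vimage[OF permutes_swap_id])
  have Z_add: "Z (g + g')" if "Z g" "Z g'" for g g'
  proof -
    obtain h h' where "lie S h" "lie S h'" "lowdeg ?A T (g - h)" "lowdeg ?A T (g' - h')"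
      using \<open>Z g\<close> \<open>Z g'\<close> unfolding Z_def by blast
    then show ?thesis unfolding Z_def
      using lie.add[of S h h'] lowdeg_add[of ?A T "g - h" "g' - h'"]
      by (intro exI[of _ "h + h'"]) (simp add: algebra_simps)
  qed
  have Z_diff: "Z (g - g')" if "Z g" "Z g'" for g g'
  proof -
    obtain h h' where "lie S h" "lie S h'" "lowdeg ?A T (g - h)" "lowdeg ?A T (g' - h')"
      using \<open>Z g\<close> \<open>Z g'\<close> unfolding Z_def by blast
    then show ?thesis unfolding Z_def
      using lie_diff[of S h h'] lowdeg_diff[of ?A T "g - h" "g' - h'"]
      by (intro exI[of _ "h - h'"]) (simp add: algebra_simps)
  qed
  have Z_low: "Z g" if "lowdeg ?A T g" for g
    unfolding Z_def using that S by (intro exI[of _ 0]) (simp add: lie.zero)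
  have Z_sum: "Z (sum g I)" if "\<And>i. i \<in> I \<Longrightarrow> Z (g i)" for g :: "nat \<Rightarrow> _" and I
    using that by (induction I rule: infinite_finite_induct) (simp_all add: Z_add Z_low)
  have part: "part ?A T f = (\<Sum>r\<le>T. F r r)"
  proof -
    have "inj_on a {..T}"
    proof (rule inj_onI)
      fix r s assume "a r = a s"
      then have "expo (a r) v = expo (a s) v" by simp
      then show "r = s" using vw(3) by (simp add: a_def lookup_add lookup_single when_def)
    qed
    moreover have "\<exists>b\<in>a ` {..T}. \<forall>i\<in>?A. expo m i = expo b i" if "adeg ?A m = T" for m
    proof -
      have "expo m v + expo m w = T" using that vw(3) by (simp add: adeg_def)
      then show ?thesis
        using vw(3) by (intro bexI[of _ "a (expo m v)"]) (auto simp: a_def lookup_add lookup_single when_def)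
    qed
    ultimately have "part ?A T f = (\<Sum>r\<le>T. Poly_Mapping.single (a r) 1 * c r)"
      using a by (subst part_eq_sum_slices[of "a ` {..T}"]) (auto simp: sum.reindex c_def)
    also have "\<dots> = (\<Sum>r\<le>T. F r r)"
      unfolding F_def a_def single_eq_power[symmetric] by (simp add: mult_single)
    finally show ?thesis .
  qed
  have step: "Z (F r (Suc i) - F r i)" if r: "r \<le> T" and i: "i < T" for r i
  proof -
    \<comment> \<open>The weight is 1 + T - 2; it is not truncated, because i < T gives T >=
      1.\<close>
    have "invariant (S - ?A) (T - 1) (c r)"
      unfolding c_def using vw i by (intro invariant_slice[OF S _ f a(1) a(2)[OF r]]) auto
    have "\<exists>h. lie S h \<and> leads ?A T h (var v ^ i * var w ^ (T - 1 - i) * (var v - var w) * c r)"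
    proof (cases "T = 1")
      case True
      \<comment> \<open>For T = 1 the coefficient has weight 0, out of reach of the induction
        hypothesis. Regarded as a polynomial on the variables including w it has weight 1, and that
        set is still smaller than S.\<close>
      have "insert w (S - ?A) = S - {v}" using vw by auto
      then have "invariant (S - {v}) 1 (c r)"
        using invariant_insert[of "S - ?A" w 0 "c r"] S \<open>invariant (S - ?A) (T - 1) (c r)\<close> True by simp
      then have "pois (S - {v}) 1 (c r)" using IH[of "S - {v}" 1] vw by auto
      then have "lie (S - {v}) (c r)" by (rule pois_1) simp
      from lie.bracket[OF this lie.unit[of v]]
      have "lie (S - {v} \<union> {v}) (c r * 1 * (vsum {v} - vsum (S - {v})))" by simp
      moreover have "S - {v} \<union> {v} = S" "(S - {v}) \<inter> ?A = {w}" "{v} \<inter> ?A = {v}" using vw by auto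
      moreover have "leads ?A (0 + 1) (c r * (vsum {v} - vsum (S - {v}))) (c r * (vsum ({v} \<inter> ?A) - vsum ((S - {v}) \<inter> ?A)))"
        using S \<open>invariant (S - ?A) (T - 1) (c r)\<close>
        by (intro leads_mult leads_refl[OF invariant_polys_in] leads_vsum) auto
      ultimately show ?thesis
        using True i by (intro exI[of _ "c r * (vsum {v} - vsum (S - {v}))"]) (simp add: vsum_def mult.commute)
    next
      case False
      then have "T - 1 \<ge> 1" "S - ?A \<subset> S" using i vw by auto
      then have "pois (S - ?A) (T - 1) (c r)"
        using IH \<open>invariant (S - ?A) (T - 1) (c r)\<close> by blast
      from lie_leading[OF this vw(3) lie.unit[of v] lie.unit[of w] _ _ _ _ _
          leads_refl[OF polys_in_one[of "{}"]] leads_refl[OF polys_in_one[of "{}"]], of i "T - 1 - i"]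
      obtain h where "lie ({v} \<union> {w} \<union> (S - ?A)) h"
        "leads ?A (0 + 0 + (T - 1) + 1) h (var v ^ i * var w ^ (T - 1 - i) * (var v - var w) * (1 * 1 * c r))"
        using vw(3) i by auto
      moreover have "{v} \<union> {w} \<union> (S - ?A) = S" "0 + 0 + (T - 1) + 1 = T" using vw i by auto
      ultimately show ?thesis by (intro exI[of _ h]) simp
    qed
    moreover have "F r (Suc i) - F r i = var v ^ i * var w ^ (T - 1 - i) * (var v - var w) * c r"
    proof -
      define j where "j = T - 1 - i"
      have "T - i = Suc j" "T - Suc i = j" using i by (auto simp: j_def)
      then show ?thesis unfolding F_def j_def[symmetric] by (simp add: algebra_simps)
    qed
    ultimately show ?thesis
      unfolding Z_def by (metis lowdeg_of_leads diff_self lowdeg_zero)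
  qed
  have Z0: "Z (F r i - F r 0)" if "r \<le> T" "i \<le> T" for r i
    using that(2)
  proof (induction i)
    case (Suc i)
    then have "Z ((F r (Suc i) - F r i) + (F r i - F r 0))" using step[OF that(1), of i] by (intro Z_add) auto
    then show ?case by simp
  qed (simp add: Z_low)
  have act_F: "act ?p (F r i) = F r (T - i)" if "i \<le> T" for r i
  proof -
    have "polys_in (S - ?A) (c r)"
      unfolding c_def by (rule polys_in_slice[OF a(1) invariant_polys_in[OF f(1)]])
    then have "act ?p (c r) = c r" using p(1) by (intro act_fixed[of ?p "S - ?A"]) auto
    then show ?thesis
      using p that by (simp add: F_def act_mult act_power act_var mult.commute)
  qed
  \<comment> \<open>The transpose of \<open>F r r\<close> is \<open>F r (T - r)\<close>, and both
    are congruent to \<open>F r 0\<close>.\<close>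
  have "Z (F r r - act ?p (F r r))" if "r \<le> T" for r
    using Z_diff[OF Z0[OF that that] Z0[OF that, of "T - r"]] act_F[OF that] by simp
  then have "Z (part ?A T f - act ?p (part ?A T f))"
    unfolding part act_sum sum_subtractf[symmetric] by (intro Z_sum) simp
  moreover have "lowdeg ?A T (f - part ?A T f)" by (rule lowdeg_diff_part[OF f(2)])
  then have "Z ((f - part ?A T f) - act ?p (f - part ?A T f))"
    by (intro Z_low lowdeg_diff[OF _ lowdeg_act[OF p(4)]])
  ultimately have "Z ((part ?A T f - act ?p (part ?A T f)) + ((f - part ?A T f) - act ?p (f - part ?A T f)))"
    by (rule Z_add)
  then show ?thesis unfolding Z_def act_diff by (simp add: algebra_simps)
qed

text \<open>With p the transposition and g = f - p f - h the remainder of the single step, induction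
  on T shows that g - p g is Lie. As p is an involution, g - p g = 2 (f - p f) - (h - p h), and
  division by 2 finishes.\<close>

lemma transpose_congruent:
  fixes f :: "('v, 'k::field_char_0) mpoly"
  assumes S: "finite S" and vw: "v \<in> S" "w \<in> S" "v \<noteq> w"
    and IH: "\<And>S' l c. S' \<subset> S \<Longrightarrow> invariant S' l c \<Longrightarrow> l \<ge> 1 \<Longrightarrow> pois S' l (c :: ('v, 'k) mpoly)"
  shows "invariant S 1 f \<Longrightarrow> lowdeg {v, w} T f \<Longrightarrow> lie S (f - act (Transposition.transpose v w) f)"
proof (induction T arbitrary: f)
  case 0
  then show ?case using S by (simp add: lowdeg_zero_iff lie.zero)
next
  case (Suc T)
  let ?p = "Transposition.transpose v w"
  have p: "bij ?p" "?p permutes S" "?p -` S = S"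
    using vw by (auto simp: permutes_swap_id permutes_vimage[OF permutes_swap_id])
  obtain h where h: "lie S h" "lowdeg {v, w} T (f - act ?p f - h)"
    using transpose_congruent_step[OF S vw IH Suc.prems] by blast
  have "invariant S 1 (act ?p f)" using S p(2) Suc.prems(1) by (rule invariant_act)
  then have "invariant S 1 (f - act ?p f - h)"
    using Suc.prems(1) lie_invariant[OF h(1)] by (intro invariant_diff)
  then have "lie S ((f - act ?p f - h) - act ?p (f - act ?p f - h))"
    using h(2) by (rule Suc.IH)
  moreover have "lie S (act ?p h)" using lie_act[OF p(1) h(1)] p(3) by simp
  then have "lie S (h - act ?p h)" by (rule lie_diff[OF h(1)])
  ultimately have "lie S (((f - act ?p f - h) - act ?p (f - act ?p f - h)) + (h - act ?p h))"
    by (rule lie.add)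
  also have "((f - act ?p f - h) - act ?p (f - act ?p f - h)) + (h - act ?p h) = scale 2 (f - act ?p f)"
  proof -
    have "act ?p (act ?p f) = f" using p(1) by (simp add: act_act)
    then show ?thesis
      using scale_of_nat[of 2 "f - act ?p f"] by (simp add: act_diff act_add algebra_simps)
  qed
  finally have "lie S (scale (inverse 2) (scale 2 (f - act ?p f)))" by (rule lie.scale)
  then show ?case by (simp add: scale_scale)
qed

section \<open>Invariants are Lie polynomials\<close>

text \<open>Induction on the number of variables of a monomial m. Write m as b times t_i^e with t_i
  not in b, and read off the coefficient of b in \<open>witt e S f = 0\<close>: variables of b
  contribute coefficients of monomials with fewer variables, and by symmetry every other variable
  contributes the same nonzero multiple of the coefficient of m. The assumption k <
  \<open>card S\<close> excludes the constant monomial.\<close>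

lemma symmetric_invariant_zero:
  fixes f :: "('v, 'k::field_char_0) mpoly"
  assumes S: "finite S" and f: "invariant S k f" and k: "k < card S"
    and sym: "\<And>v w. v \<in> S \<Longrightarrow> w \<in> S \<Longrightarrow> act (Transposition.transpose v w) f = f"
  shows "f = 0"
proof -
  have "coeff f m = 0" if "vars m \<subseteq> S" "card (vars m) = q" for q m
    using that
  proof (induction q arbitrary: m)
    case 0
    then have "m = 0" by simp
    have "m \<notin> monoms f"
    proof
      assume "m \<in> monoms f"
      then have "mdegree m + k = card S" using f unfolding invariant_def by blast
      then show False using \<open>m = 0\<close> k by simp
    qed
    then show ?case by (simp add: in_keys_iff)
  next
    case (Suc q)
    then obtain i where i: "i \<in> vars m" by fastforce
    define e where "e = expo m i"
    define b where "b = m - Poly_Mapping.single i e"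
    have e: "e \<ge> 1" using i by (auto simp: e_def in_keys_iff)
    have expo_b: "expo b j = (if j = i then 0 else expo m j)" for j
      by (simp add: b_def e_def lookup_minus lookup_single when_def)
    have m: "b + Poly_Mapping.single i e = m"
      by (rule poly_mapping_eqI) (simp add: lookup_add expo_b lookup_single when_def e_def)
    have vars_b: "vars b = vars m - {i}" by (auto simp: in_keys_iff expo_b split: if_splits)
    \<comment> \<open>N is (e + 1)!: the factor e + 1 comes from \<open>witt_at\<close>, and e! from
      the e-th derivative of t_j^e.\<close>
    define N :: 'k where "N = of_nat (Suc e) * of_nat (\<Prod>l<e. Suc l)"
    \<comment> \<open>Both terms of \<open>witt_at e j f\<close> have at b a multiple of the
      coefficient of b t_j^e, a monomial with only q variables.\<close>
    have in_b: "coeff (witt_at e j f) b = 0" if j: "j \<in> vars b" for j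
    proof -
      have "vars (b + Poly_Mapping.single j e) = vars b" using j e by auto
      then have 0: "coeff f (b + Poly_Mapping.single j e) = 0"
        using Suc i vars_b by (intro Suc.IH) auto
      have "b - Poly_Mapping.single j 1 + Poly_Mapping.single j (Suc e) = b + Poly_Mapping.single j e"
        using j by (intro poly_mapping_eqI)
          (auto simp: lookup_add lookup_minus lookup_single when_def in_keys_iff)
      then show ?thesis
        using 0 unfolding witt_at_def scale_of_nat[symmetric]
        by (simp add: lookup_minus coeff_var_mult coeff_pd_funpow coeff_scale del: funpow.simps)
    qed
    have not_in_b: "coeff (witt_at e j f) b = - (N * coeff f m)" if j: "j \<in> S - vars b" for j
    proof -
      let ?p = "Transposition.transpose i j"
      have bj: "expo b j = 0" using j by (simp add: in_keys_iff)
      have "expo (b + Poly_Mapping.single j e) (?p l) = expo (b + Poly_Mapping.single i e) l" for l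
        using bj expo_b[of i] by (cases "l = i"; cases "l = j") (auto simp: lookup_add lookup_single when_def)
      then have "Poly_Mapping.map_key ?p (b + Poly_Mapping.single j e) = m"
        unfolding m by (intro poly_mapping_eqI) (simp add: lookup_map_key)
      then have "coeff (act ?p f) (b + Poly_Mapping.single j e) = coeff f m"
        by (simp add: coeff_act)
      then have "coeff f (b + Poly_Mapping.single j e) = coeff f m"
        using sym[of i j] i j Suc.prems(1) by auto
      then show ?thesis
        using bj unfolding witt_at_def scale_of_nat[symmetric]
        by (simp add: lookup_minus coeff_var_mult coeff_pd_funpow coeff_scale N_def del: funpow.simps of_nat_Suc of_nat_prod)
    qed
    have "vars b \<subseteq> S" using Suc.prems(1) vars_b by auto
    then have "witt e S f = witt e (S - vars b) f + witt e (vars b) f"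
      using S by (simp add: witt_def sum.subset_diff)
    moreover have "witt e S f = 0" using f e by (simp add: invariant_def)
    ultimately have "0 = coeff (witt e (S - vars b) f) b + coeff (witt e (vars b) f) b"
      by (metis lookup_add lookup_zero)
    also have "\<dots> = - (of_nat (card (S - vars b)) * N * coeff f m)"
      by (simp add: witt_def lookup_sum in_b not_in_b)
    finally have "of_nat (card (S - vars b)) * N * coeff f m = 0" by simp
    moreover have "i \<in> S - vars b" using i Suc.prems(1) vars_b by auto
    then have "card (S - vars b) \<noteq> 0" using S by auto
    moreover have "N \<noteq> 0" unfolding N_def by (simp del: of_nat_Suc of_nat_prod)
    ultimately show ?case by simp
  qed
  then show ?thesis
    using f by (intro poly_mapping_eqI) (metis in_keys_iff invariant_def lookup_zero)
qed

section \<open>Symmetrization and the induction on the set of variables\<close>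

lemma ex_lowdeg: "\<exists>T. lowdeg A T f"
proof
  show "lowdeg A (Suc (\<Sum>m\<in>monoms f. adeg A m)) f"
    unfolding lowdeg_def by (auto simp: less_Suc_eq_le intro: member_le_sum)
qed

text \<open>A permutation is a product of transpositions t, and the difference for t o p is (f - p
  f) + p (f - t f). As \<open>act\<close> is a right action, t acts first.\<close>

lemma permutes_congruent:
  fixes f :: "('v, 'k::field_char_0) mpoly"
  assumes S: "finite S"
    and IH: "\<And>S' l c. S' \<subset> S \<Longrightarrow> invariant S' l c \<Longrightarrow> l \<ge> 1 \<Longrightarrow> pois S' l (c :: ('v, 'k) mpoly)"
    and f: "invariant S 1 f" and p: "p permutes S"
  shows "lie S (f - act p f)"
  using p S
proof (induction rule: permutes_induct)
  case id
  show ?case unfolding act_id diff_self by (rule lie.zero[OF S])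
next
  case (swap v w p)
  let ?t = "Transposition.transpose v w"
  obtain T where "lowdeg {v, w} T f" using ex_lowdeg by blast
  have 1: "lie S (f - act ?t f)"
    using swap.hyps by (intro transpose_congruent[OF S _ _ _ IH f \<open>lowdeg {v, w} T f\<close>])
  have b: "bij p" "bij ?t" "p -` S = S" using swap by (auto simp: permutes_bij permutes_vimage)
  have "lie S (act p (f - act ?t f))" using lie_act[OF b(1) 1] b(3) by simp
  then have "lie S ((f - act p f) + act p (f - act ?t f))" by (rule lie.add[OF swap.IH])
  then show ?case
    unfolding act_diff act_act[OF b(1,2)] by (simp only: add_diff_eq diff_add_cancel)
qed

lemma lie_pois: "lie S f \<Longrightarrow> pois S 1 f"
  using pois.mult[OF _ pois.unit, of S f] by simp

text \<open>Singletons are treated apart: there the weight 1 equals \<open>card S\<close>, and the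
  nonzero constants are symmetric invariants.\<close>

theorem invariant_pois:
  fixes f :: "('v, 'k::field_char_0) mpoly"
  assumes "finite S" "invariant S k f" "k \<ge> 1"
  shows "pois S k f"
  using assms
proof (induction arbitrary: k f rule: finite_psubset_induct)
  case (psubset S)
  note S = psubset.hyps(1) and f = psubset.prems(1)
  have IH: "pois S' l c" if "S' \<subset> S" "invariant S' l c" "l \<ge> 1" for S' l and c :: "('v, 'k) mpoly"
    using psubset.IH that by blast
  consider "S = {}" | "S \<noteq> {}" "k \<ge> 2" | v where "k = 1" "S = {v}" | "k = 1" "card S \<ge> 2"
  proof -
    have "card S = 0 \<or> card S = 1 \<or> card S \<ge> 2" "k = 1 \<or> k \<ge> 2" using psubset.prems(2) by linarith+
    then show ?thesis using that S by (auto simp: card_1_singleton_iff)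
  qed
  then show ?case
  proof cases
    case 1
    then have "monoms f = {}" using f psubset.prems(2) by (auto simp: invariant_def)
    then show ?thesis using S by (simp add: pois.zero)
  next
    case 2
    then obtain v where v: "v \<in> S" by blast
    obtain T where "lowdeg {v} T f" using ex_lowdeg by blast
    moreover have "S - {v} \<subset> S" using v by blast
    ultimately show ?thesis by (intro invariant_pois_step[OF S v 2(2) IH f])
  next
    case 3
    have "f = scale (coeff f 0) 1"
    proof (rule poly_mapping_eqI)
      fix m
      show "coeff f m = coeff (scale (coeff f 0) 1) m"
      proof (cases "m \<in> monoms f")
        case True
        then have "vars m \<subseteq> {v}" "mdegree m = 0" using f 3 by (auto simp: invariant_def)
        moreover from this have "v \<notin> vars m" using mdegree_eq_adeg[of "{v}" m] by (simp add: adeg_def in_keys_iff)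
        ultimately have "vars m = {}" by blast
        then have "m = 0" by simp
        then show ?thesis by (simp add: coeff_scale)
      qed (auto simp: coeff_scale lookup_one when_def in_keys_iff)
    qed
    then have "lie S f" using 3 lie.scale[OF lie.unit[of v], of "coeff f 0"] by simp
    then show ?thesis using 3 lie_pois by simp
  next
    case 4
    let ?P = "{p. p permutes S}"
    have f1: "invariant S 1 f" using f 4 by simp
    \<comment> \<open>The symmetrization has weight 1 < \<open>card S\<close> and hence vanishes, so
      \<open>card ?P\<close> times f is the sum of the Lie polynomials f - p f.\<close>
    define s where "s = (\<Sum>p\<in>?P. act p f)"
    have "invariant S 1 s"
      unfolding s_def by (rule invariant_sum) (use S f1 in \<open>auto intro: invariant_act\<close>)
    moreover have "act (Transposition.transpose v w) s = s" if "v \<in> S" "w \<in> S" for v w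
    proof -
      let ?t = "Transposition.transpose v w"
      have t: "?t permutes S" using that by (rule permutes_swap_id)
      have "act ?t s = (\<Sum>p\<in>?P. act (p \<circ> ?t) f)"
        unfolding s_def act_sum by (intro sum.cong refl) (simp add: act_act permutes_bij)
      then show ?thesis
        unfolding s_def using sum_permutations_compose_right[OF t, of "\<lambda>p. act p f"] by simp
    qed
    ultimately have "s = 0" using 4 by (intro symmetric_invariant_zero[OF S]) auto
    have "lie S (\<Sum>p\<in>?P. f - act p f)"
      using S by (rule lie_sum) (use permutes_congruent[OF S IH f1] in auto)
    also have "(\<Sum>p\<in>?P. f - act p f) = scale (of_nat (card ?P)) f"
      using \<open>s = 0\<close> by (simp add: sum_subtractf s_def scale_of_nat)
    finally have "lie S (scale (of_nat (card ?P)) f)" .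
    then have "lie S (scale (inverse (of_nat (card ?P))) (scale (of_nat (card ?P)) f))" by (rule lie.scale)
    moreover have "(of_nat (card ?P) :: 'k) \<noteq> 0"
      using S card_permutations[OF refl S] by simp
    ultimately have "lie S f" by (simp add: scale_inverse)
    then show ?thesis using 4 lie_pois by simp
  qed
qed

corollary lie_iff_invariant:
  fixes f :: "('v, 'k::field_char_0) mpoly"
  assumes "finite S"
  shows "lie S f \<longleftrightarrow> invariant S 1 f"
  using lie_invariant pois_1[OF invariant_pois[OF assms, of 1 f]] by auto

section \<open>Multilinear Lie elements\<close>

lemma x_degree_superset:
  "finite V \<Longrightarrow> vars m \<subseteq> V \<Longrightarrow> x_degree i m = (\<Sum>v\<in>V. if fst v = i then expo m v else 0)"
  unfolding x_degree_def
  by (subst sum.inter_filter[symmetric]) (auto simp: in_keys_iff intro!: sum.mono_neutral_left)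

lemma x_degree_add: "x_degree i (l + m) = x_degree i l + x_degree i m"
proof -
  let ?V = "vars l \<union> vars m"
  have *: "x_degree i k = (\<Sum>v\<in>?V. if fst v = i then expo k v else 0)" if "vars k \<subseteq> ?V" for k
    by (rule x_degree_superset[OF _ that]) simp
  have "x_degree i (l + m) = (\<Sum>v\<in>?V. (if fst v = i then expo l v else 0) + (if fst v = i then expo m v else 0))"
    by (subst *) (auto simp: lookup_add intro!: sum.cong)
  then show ?thesis by (simp add: sum.distrib *)
qed

lemma x_degree_single: "x_degree i (Poly_Mapping.single v 1) = (if fst v = i then 1 else 0)"
  by (simp add: x_degree_superset[of "{v}"])

lemma symbol_monom_superset:
  "finite V \<Longrightarrow> vars m \<subseteq> V \<Longrightarrow> symbol_monom m = (\<Sum>v\<in>V. Poly_Mapping.single (fst v) (expo m v * snd v))"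
  unfolding symbol_monom_def by (rule sum.mono_neutral_left) (auto simp: in_keys_iff)

lemma symbol_monom_add: "symbol_monom (l + m) = symbol_monom l + symbol_monom m"
  by (simp add: symbol_monom_superset[of "vars l \<union> vars m"] lookup_add distrib_right single_add sum.distrib)

lemma symbol_monom_single: "symbol_monom (Poly_Mapping.single v 1) = Poly_Mapping.single (fst v) (snd v)"
  by (simp add: symbol_monom_superset[of "{v}"])

lemma symbol_mult: "symbol (f * g) = symbol f * symbol g"
  unfolding symbol_def by (rule lin_ext_mult_hom) (simp add: symbol_monom_add mult_single)

lemma symbol_zero [simp]: "symbol 0 = 0"
  using symbol_scale[of 0 0] by simp

lemma symbol_diff: "symbol (f - g) = symbol f - symbol g"
  using symbol_add[of "f - g" g] by (simp add: algebra_simps)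

lemma symbol_sum: "symbol (sum f I) = (\<Sum>i\<in>I. symbol (f i))"
  by (induction I rule: infinite_finite_induct) (simp_all add: symbol_add)

text \<open>In contrast to \<open>Nov_multilinear\<close>, degree 0 is demanded for every index
  outside S, so that a monomial is multilinear for at most one S.\<close>

definition multilinear :: "nat set \<Rightarrow> dvar monomial \<Rightarrow> bool" where
  "multilinear S m \<longleftrightarrow> (\<forall>i. x_degree i m = (if i \<in> S then 1 else 0))"

text \<open>A multilinear Lie element may be built from elements that are not multilinear. An
  induction over its construction therefore has to speak about the projections of arbitrary Lie
  elements.\<close>

definition multilinear_part :: "nat set \<Rightarrow> (dvar, 'k::field) mpoly \<Rightarrow> (dvar, 'k) mpoly" where
  "multilinear_part S = lin_ext (\<lambda>m. if multilinear S m then Poly_Mapping.single m 1 else 0)"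

lemma multilinear_part_single: "multilinear_part S (Poly_Mapping.single m c) = (if multilinear S m then Poly_Mapping.single m c else 0)"
  by (simp add: multilinear_part_def lin_ext_single scale_def mult_single)

lemma multilinear_part_add: "multilinear_part S (f + g) = multilinear_part S f + multilinear_part S g"
  by (simp add: multilinear_part_def lin_ext_add)

lemma multilinear_part_scale: "multilinear_part S (scale c f) = scale c (multilinear_part S f)"
  by (simp add: multilinear_part_def lin_ext_scale)

lemma multilinear_part_zero [simp]: "multilinear_part S 0 = 0"
  using multilinear_part_scale[of S 0 0] by simp

lemma multilinear_part_diff: "multilinear_part S (f - g) = multilinear_part S f - multilinear_part S g"
  using multilinear_part_add[of S "f - g" g] by (simp add: algebra_simps)

lemma multilinear_part_sum: "multilinear_part S (sum f I) = (\<Sum>i\<in>I. multilinear_part S (f i))"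
  by (induction I rule: infinite_finite_induct) (simp_all add: multilinear_part_add)

lemma coeff_multilinear_part: "coeff (multilinear_part S f) m = (if multilinear S m then coeff f m else 0)"
  by (induction f rule: mpoly_induct)
     (auto simp: multilinear_part_single multilinear_part_add lookup_add lookup_single when_def)

lemma multilinear_part_eq_iff: "multilinear_part S f = f \<longleftrightarrow> (\<forall>m\<in>monoms f. multilinear S m)"
  by (auto simp: poly_mapping_eq_iff fun_eq_iff coeff_multilinear_part in_keys_iff)

text \<open>A product of two monomials is multilinear in S exactly if the factors are multilinear in
  complementary subsets of S.\<close>

lemma multilinear_part_mult:
  assumes "finite S"
  shows "multilinear_part S (f * g) = (\<Sum>A\<in>Pow S. multilinear_part A f * multilinear_part (S - A) g)"
proof (rule bilinear_ext[where B = "\<lambda>f g. multilinear_part S (f * g)"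
      and C = "\<lambda>f g. \<Sum>A\<in>Pow S. multilinear_part A f * multilinear_part (S - A) g"], goal_cases)
  case (5 l m c d)
  \<comment> \<open>For fixed monomials l and m, the set of indices of degree 1 in l is the only A
    that can contribute.\<close>
  define A0 where "A0 = {i. x_degree i l = 1}"
  have *: "A \<subseteq> S \<and> multilinear A l \<and> multilinear (S - A) m \<longleftrightarrow> multilinear S (l + m) \<and> A = A0" for A
  proof
    assume A: "A \<subseteq> S \<and> multilinear A l \<and> multilinear (S - A) m"
    have "A = A0" using A by (auto simp: multilinear_def A0_def)
    then show "multilinear S (l + m) \<and> A = A0"
      using A by (auto simp: multilinear_def x_degree_add)
  next
    assume A: "multilinear S (l + m) \<and> A = A0"
    then have s: "x_degree i l + x_degree i m = (if i \<in> S then 1 else 0)" for i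
      by (simp add: multilinear_def x_degree_add)
    have "x_degree i l = (if i \<in> A0 then 1 else 0) \<and> x_degree i m = (if i \<in> S - A0 then 1 else 0)
        \<and> (i \<in> A0 \<longrightarrow> i \<in> S)" for i
      using s[of i] by (auto simp: A0_def split: if_splits)
    then show "A \<subseteq> S \<and> multilinear A l \<and> multilinear (S - A) m"
      using A by (auto simp: multilinear_def)
  qed
  have "(\<Sum>A\<in>Pow S. multilinear_part A (Poly_Mapping.single l c) * multilinear_part (S - A) (Poly_Mapping.single m d))
     = (\<Sum>A\<in>Pow S. if A = A0 then (if multilinear S (l + m) then Poly_Mapping.single (l + m) (c * d) else 0) else 0)"
  proof (rule sum.cong[OF refl])
    fix A assume "A \<in> Pow S"
    then show "multilinear_part A (Poly_Mapping.single l c) * multilinear_part (S - A) (Poly_Mapping.single m d) =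
      (if A = A0 then (if multilinear S (l + m) then Poly_Mapping.single (l + m) (c * d) else 0) else 0)"
      using *[of A] by (auto simp: multilinear_part_single mult_single)
  qed
  also have "\<dots> = multilinear_part S (Poly_Mapping.single l c * Poly_Mapping.single m d)"
    using *[of A0] assms by (auto simp: mult_single multilinear_part_single sum.delta)
  finally show ?case by simp
qed (simp_all add: multilinear_part_add algebra_simps sum.distrib)

lemma D_monom_eq:
  "D_monom m = (\<Sum>v\<in>vars m. Poly_Mapping.single
     (m - Poly_Mapping.single v 1 + Poly_Mapping.single (fst v, Suc (snd v)) 1) (of_nat (expo m v)))"
  by (simp add: D_monom_def pderiv_monom_def var_def mult_single)

text \<open>The effect of one Leibniz term of \<open>D\<close>, which raises the order of derivation
  of a single factor.\<close>

lemma shift_monom: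
  assumes "v \<in> vars m"
  defines "m' \<equiv> m - Poly_Mapping.single v 1 + Poly_Mapping.single (fst v, Suc (snd v)) (1::nat)"
  shows "x_degree i m' = x_degree i m" "symbol_monom m' = symbol_monom m + Poly_Mapping.single (fst v) 1"
proof -
  let ?e = "Poly_Mapping.single v (1::nat)" and ?e' = "Poly_Mapping.single (fst v, Suc (snd v)) (1::nat)"
  have m: "m = (m - ?e) + ?e"
    using assms(1) by (intro poly_mapping_eqI) (auto simp: lookup_add lookup_minus lookup_single when_def in_keys_iff)
  show "x_degree i m' = x_degree i m"
    unfolding m'_def by (subst (2) m) (simp only: x_degree_add x_degree_single fst_conv)
  show "symbol_monom m' = symbol_monom m + Poly_Mapping.single (fst v) 1"
    unfolding m'_def
    by (subst (2) m) (simp only: symbol_monom_add symbol_monom_single fst_conv snd_conv Suc_eq_plus1 single_add add.assoc)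
qed

lemma multilinear_part_D: "multilinear_part S (D f) = D (multilinear_part S f)"
proof (induction f rule: mpoly_induct)
  case (single m c)
  have "multilinear_part S (D_monom m :: (dvar, 'a) mpoly) = (if multilinear S m then D_monom m else 0)"
  proof -
    have "multilinear_part S (D_monom m :: (dvar, 'a) mpoly) = (\<Sum>v\<in>vars m. if multilinear S m then Poly_Mapping.single
        (m - Poly_Mapping.single v 1 + Poly_Mapping.single (fst v, Suc (snd v)) 1) (of_nat (expo m v)) else 0)"
      unfolding D_monom_eq multilinear_part_sum multilinear_part_single multilinear_def
      by (intro sum.cong refl) (simp only: shift_monom(1))
    then show ?thesis by (simp add: D_monom_eq)
  qed
  then show ?case
    by (auto simp: multilinear_part_single D_def lin_ext_single multilinear_part_scale lin_ext_scale[of _ 0 0, simplified])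
qed (simp add: D_add multilinear_part_add)

text \<open>On a monomial m, \<open>D\<close> multiplies the symbol by the sum of
  \<open>x_degree i m\<close> times t_i over the indices i; multilinearity makes all these degrees 1
  on S.\<close>

lemma symbol_D_multilinear:
  assumes S: "finite S"
  shows "symbol (D (multilinear_part S f)) = vsum S * symbol (multilinear_part S f)"
proof (induction f rule: mpoly_induct)
  case (single m c)
  show ?case
  proof (cases "multilinear S m")
    case True
    have fst_S: "fst ` vars m \<subseteq> S"
    proof
      fix i assume "i \<in> fst ` vars m"
      then obtain v where v: "v \<in> vars m" "fst v = i" by auto
      then have "expo m v \<le> x_degree i m"
        unfolding x_degree_def by (intro member_le_sum) auto
      then have "x_degree i m \<noteq> 0" using v by (auto simp: in_keys_iff)
      then show "i \<in> S" using True by (auto simp: multilinear_def split: if_splits)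
    qed
    have "symbol (D_monom m) = (\<Sum>v\<in>vars m. scale (of_nat (expo m v)) (Poly_Mapping.single (symbol_monom m + Poly_Mapping.single (fst v) 1) 1))"
      unfolding D_monom_eq symbol_sum
      by (intro sum.cong refl) (simp only: symbol_def lin_ext_single shift_monom(2))
    also have "\<dots> = (\<Sum>v\<in>vars m. scale (of_nat (expo m v)) (var (fst v))) * Poly_Mapping.single (symbol_monom m) 1"
      unfolding sum_distrib_right by (intro sum.cong refl) (simp add: var_def scale_mult_left mult_single add.commute)
    also have "(\<Sum>v\<in>vars m. scale (of_nat (expo m v)) (var (fst v))) =
        (\<Sum>i\<in>S. \<Sum>v | v \<in> vars m \<and> fst v = i. scale (of_nat (expo m v)) (var (fst v) :: (nat, 'a) mpoly))"
      using S fst_S by (intro sum.group[symmetric]) auto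
    also have "\<dots> = (\<Sum>i\<in>S. scale (of_nat (x_degree i m)) (var i))"
      unfolding scale_of_nat unfolding x_degree_def of_nat_sum sum_distrib_right by (intro sum.cong refl) auto
    also have "\<dots> = vsum S"
      using True by (simp add: multilinear_def vsum_def)
    finally show ?thesis
      using True
      by (simp add: multilinear_part_single D_def lin_ext_single symbol_scale scale_mult_right)
        (simp add: symbol_def lin_ext_single scale_mult_right)
  qed (simp add: multilinear_part_single D_def lin_ext_scale[of _ 0 0, simplified])
qed (simp add: multilinear_part_add D_add symbol_add distrib_left)

text \<open>The projection of a bracket is a sum over the splittings of S into A and S - A, and each
  splitting yields one application of the rule \<open>bracket\<close>.\<close>

lemma lie_symbol_multilinear_part:
  fixes f :: "(dvar, 'k::field) mpoly"
  assumes "f \<in> lie_elements n" "finite S"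
  shows "lie S (symbol (multilinear_part S f))"
  using assms unfolding lie_elements_def
proof (induction arbitrary: S rule: subalgebra_gen.induct)
  case (gen f)
  then obtain i where f: "f = var (i, 0)" by (auto simp: gens_def)
  have S: "multilinear S (Poly_Mapping.single (i, 0) 1) \<longleftrightarrow> S = {i}"
    unfolding multilinear_def x_degree_single by (auto split: if_splits)
  have "symbol (Poly_Mapping.single (Poly_Mapping.single (i, 0) 1) 1) = (1 :: (nat, 'k) mpoly)"
    using symbol_monom_single[of "(i, 0)"] by (simp add: symbol_def lin_ext_single)
  then show ?case
    using gen.prems unfolding f var_def multilinear_part_single S by (simp add: lie.unit lie.zero)
next
  case (mult f g)
  have prod: "symbol (multilinear_part S (f \<circ>\<^sub>N g)) =
      (\<Sum>A\<in>Pow S. symbol (multilinear_part A f) * symbol (multilinear_part (S - A) g) * vsum (S - A))" for f g :: "(dvar, 'k) mpoly"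
    using mult.prems unfolding nov_prod_def multilinear_part_mult[OF mult.prems] symbol_sum symbol_mult multilinear_part_D
    by (intro sum.cong refl) (simp add: symbol_D_multilinear)
  \<comment> \<open>Exchanging A with its complement matches the terms of g o f with those of f o g,
    so that the linear factors can be subtracted.\<close>
  have "symbol (multilinear_part S (g \<circ>\<^sub>N f)) = (\<Sum>A\<in>Pow S. symbol (multilinear_part A f) * symbol (multilinear_part (S - A) g) * vsum A)"
    unfolding prod
    by (rule sum.reindex_bij_witness[where i = "\<lambda>A. S - A" and j = "\<lambda>A. S - A"])
       (auto simp: double_diff Diff_Diff_Int Int_absorb1)
  then have "symbol (multilinear_part S (nov_bracket f g)) =
      (\<Sum>A\<in>Pow S. symbol (multilinear_part A f) * symbol (multilinear_part (S - A) g) * (vsum (S - A) - vsum A))"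
    by (simp add: nov_bracket_def multilinear_part_diff symbol_diff prod right_diff_distrib sum_subtractf)
  also have "lie S \<dots>"
  proof (rule lie_sum[OF mult.prems])
    fix A assume A: "A \<in> Pow S"
    then have "lie (A \<union> (S - A)) (symbol (multilinear_part A f) * symbol (multilinear_part (S - A) g) * (vsum (S - A) - vsum A))"
      using mult by (intro lie.bracket) (auto intro: finite_subset)
    moreover have "A \<union> (S - A) = S" using A by auto
    ultimately show "lie S (symbol (multilinear_part A f) * symbol (multilinear_part (S - A) g) * (vsum (S - A) - vsum A))" by simp
  qed
  finally show ?case .
qed (simp_all add: multilinear_part_add multilinear_part_scale symbol_add symbol_scale lie.intros)

lemma D_polys_in:
  assumes "polys_in (I \<times> UNIV) f" shows "polys_in (I \<times> UNIV) (D f)"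
proof -
  have "polys_in (I \<times> UNIV) (D_monom m :: (dvar, 'a) mpoly)" if "vars m \<subseteq> I \<times> UNIV" for m
    unfolding D_monom_def
  proof (intro polys_in_sum polys_in_mult polys_in_var)
    fix v assume v: "v \<in> vars m"
    have "vars (m - Poly_Mapping.single v 1) \<subseteq> vars m"
      by (auto simp: in_keys_iff lookup_minus)
    then show "polys_in (I \<times> UNIV) (pderiv_monom v m :: (dvar, 'a) mpoly)"
      using that by (auto simp: polys_in_def pderiv_monom_def split: if_splits)
    show "(fst v, Suc (snd v)) \<in> I \<times> UNIV" using that v by auto
  qed
  then show ?thesis
    using assms unfolding D_def lin_ext_def by (intro polys_in_sum polys_in_scale) (auto simp: polys_in_def)
qed

text \<open>This controls the indices outside \<open>{1..n}\<close>, on which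
  \<open>Nov_multilinear\<close> imposes nothing.\<close>

lemma lie_elements_polys_in: "f \<in> lie_elements n \<Longrightarrow> polys_in ({1..n} \<times> UNIV) f"
  unfolding lie_elements_def
  by (induction rule: subalgebra_gen.induct)
     (auto simp: gens_def nov_bracket_def nov_prod_def
        intro!: polys_in_var polys_in_add polys_in_scale polys_in_diff polys_in_mult D_polys_in)

text \<open>Each rule of \<open>lie\<close> lifts to Lie elements. Multilinearity in exactly S is
  carried along because the symbol of \<open>D f\<close> is known only under it.\<close>

lemma ex_lie_element:
  assumes "lie S P" "S \<subseteq> {1..n}"
  shows "\<exists>f\<in>lie_elements n. multilinear_part S f = f \<and> symbol f = P"
  using assms
proof (induction rule: lie.induct)
  case (unit i)
  have "multilinear {i} (Poly_Mapping.single (i, 0) 1)"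
    unfolding multilinear_def x_degree_single by auto
  moreover have "var (i, 0) \<in> lie_elements n"
    using unit unfolding lie_elements_def by (intro subalgebra_gen.gen) (auto simp: gens_def)
  ultimately show ?case
    using symbol_monom_single[of "(i, 0)"]
    by (intro bexI[of _ "var (i, 0)"]) (simp_all add: var_def multilinear_part_single symbol_def lin_ext_single)
next
  case (zero S)
  then show ?case by (intro bexI[of _ 0]) (simp_all add: lie_elements_def subalgebra_gen.zero)
next
  case (add S P Q)
  obtain f where f: "f \<in> lie_elements n" "multilinear_part S f = f" "symbol f = P" using add by blast
  obtain g where g: "g \<in> lie_elements n" "multilinear_part S g = g" "symbol g = Q" using add by blast
  show ?case using f g
    by (intro bexI[of _ "f + g"]) (simp_all add: multilinear_part_add symbol_add lie_elements_def subalgebra_gen.add)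
next
  case (scale S P c)
  obtain f where "f \<in> lie_elements n" "multilinear_part S f = f" "symbol f = P" using scale by blast
  then show ?case
    by (intro bexI[of _ "Defs.scale c f"]) (simp_all add: multilinear_part_scale symbol_scale lie_elements_def subalgebra_gen.scale)
next
  case (bracket A P B Q)
  obtain f where f: "f \<in> lie_elements n" "multilinear_part A f = f" "symbol f = P" using bracket by blast
  obtain g where g: "g \<in> lie_elements n" "multilinear_part B g = g" "symbol g = Q" using bracket by blast
  have fin: "finite A" "finite B" using bracket.hyps lie_finite by auto
  have prod: "multilinear_part (A \<union> B) (f * g) = f * g"
    if "multilinear_part A f = f" "multilinear_part B g = g" "A \<inter> B = {}" for A B and f g :: "(dvar, 'a) mpoly"
    unfolding multilinear_part_eq_iff
  proof
    fix m assume "m \<in> monoms (f * g)"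
    then obtain a b where "m = a + b" "a \<in> monoms f" "b \<in> monoms g" by (rule monoms_mult)
    then show "multilinear (A \<union> B) m"
      using that unfolding multilinear_part_eq_iff multilinear_def by (auto simp: x_degree_add)
  qed
  have D: "multilinear_part B (D g) = D g" "multilinear_part A (D f) = D f" using f g by (simp_all add: multilinear_part_D)
  have "multilinear_part (A \<union> B) (f * D g) = f * D g" using f D bracket.hyps by (intro prod) auto
  moreover have "multilinear_part (B \<union> A) (g * D f) = g * D f" using g D bracket.hyps by (intro prod) auto
  moreover have "symbol (D g) = vsum B * Q" "symbol (D f) = vsum A * P"
    using symbol_D_multilinear[OF fin(2), of g] symbol_D_multilinear[OF fin(1), of f] f g by simp_all
  moreover have "nov_bracket f g \<in> lie_elements n"
    using f g unfolding lie_elements_def by (intro subalgebra_gen.mult)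
  ultimately show ?case
    using f(3) g(3)
    by (intro bexI[of _ "nov_bracket f g"])
       (simp_all add: nov_bracket_def nov_prod_def multilinear_part_diff symbol_diff symbol_mult Un_commute algebra_simps)
qed

lemma multilinear_part_Nov_multilinear:
  assumes "f \<in> Nov_multilinear n" "f \<in> lie_elements n"
  shows "multilinear_part {1..n} f = f"
  unfolding multilinear_part_eq_iff
proof
  fix m assume m: "m \<in> monoms f"
  then have "vars m \<subseteq> {1..n} \<times> UNIV"
    using lie_elements_polys_in[OF assms(2)] by (auto simp: polys_in_def)
  then have "x_degree i m = 0" if "i \<notin> {1..n}" for i
    unfolding x_degree_def using that by (intro sum.neutral) force
  moreover have "x_degree i m = 1" if "i \<in> {1..n}" for i
    using assms(1) m that by (simp add: Nov_multilinear_def)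
  ultimately show "multilinear {1..n} m" by (simp add: multilinear_def)
qed

theorem theorem1p2:
  fixes n :: nat and P :: "(nat, 'k::field_char_0) mpoly"
  assumes "n \<ge> 2"
    and "P \<in> homogeneous_polys n (n - 1)"
  shows "(\<exists>f \<in> Nov_multilinear n. f \<in> lie_elements n \<and> symbol f = P) \<longleftrightarrow>
      (\<Sum>i=1..n. var i * pd i (pd i P) - 2 * pd i P) = 0 \<and>
      (\<Sum>i=1..n. var i * pd i (pd i (pd i P)) - 3 * pd i (pd i P)) = 0"
proof -
  let ?S = "{1..n}"
  have "(\<exists>f \<in> Nov_multilinear n. f \<in> lie_elements n \<and> symbol f = P) \<longleftrightarrow> lie ?S P"
  proof
    assume "\<exists>f \<in> Nov_multilinear n. f \<in> lie_elements n \<and> symbol f = P"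
    then obtain f where f: "f \<in> Nov_multilinear n" "f \<in> lie_elements n" "symbol f = P" by blast
    then show "lie ?S P"
      using lie_symbol_multilinear_part[OF f(2), of ?S] unfolding multilinear_part_Nov_multilinear[OF f(1,2)] f(3) by simp
  next
    assume "lie ?S P"
    then obtain f where f: "f \<in> lie_elements n" "multilinear_part ?S f = f" "symbol f = P"
      using ex_lie_element by blast
    then have "f \<in> Nov_multilinear n"
      using lie_elements_subset_Nov
      unfolding multilinear_part_eq_iff multilinear_def Nov_multilinear_def by auto
    with f show "\<exists>f \<in> Nov_multilinear n. f \<in> lie_elements n \<and> symbol f = P" by blast
  qed
  also have "\<dots> \<longleftrightarrow> invariant ?S 1 P" by (rule lie_iff_invariant) simp
  \<comment> \<open>Homogeneity of degree n - 1 is the degree condition for weight 1 in n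
    variables.\<close>
  also have "\<dots> \<longleftrightarrow> (\<forall>j\<ge>1. witt j ?S P = 0)"
    using assms by (auto simp: invariant_def homogeneous_polys_def)
  \<comment> \<open>The fields z^2 d/dz and z^3 d/dz generate all z^(k+1) d/dz with k >= 1 in
    characteristic 0.\<close>
  also have "\<dots> \<longleftrightarrow> witt 1 ?S P = 0 \<and> witt 2 ?S P = 0"
    using witt_vanish_all[of ?S P] by auto
  also have "witt 1 ?S P = (\<Sum>i=1..n. var i * pd i (pd i P) - 2 * pd i P)"
    by (simp add: witt_def witt_at_def)
  also have "witt 2 ?S P = (\<Sum>i=1..n. var i * pd i (pd i (pd i P)) - 3 * pd i (pd i P))"
    by (simp add: witt_def witt_at_def numeral_2_eq_2)
  finally show ?thesis .
qed

end
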